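(* Let $b\neq0$ and $t$ be real numbers such that $4b^2-10bt^2+5t^4\ge 0$ and such that the right-hand side of the first formula below is positive. Then there is $r>0$ for which both $$A_r=R\left(e^{-2\pi\sqrt r}\right)^{-5}-11-R\left(e^{-2\pi\sqrt r}\right)^5=\frac{25\left(-5b+5t^2+\sqrt5\sqrt{4b^2-10bt^2+5t^4}\right)}{b}$$ and $$j_r=\frac{25000\,t^6}{b\left(-5b+5t^2+\sqrt5\sqrt{4b^2-10bt^2+5t^4}\right)^2}.$$
   Context: For $0<q<1$, $R(q)$ is the Rogers–Ramanujan continued fraction $$R(q):=\frac{q^{1/5}}{1+}\,\frac{q}{1+}\,\frac{q^2}{1+}\,\frac{q^3}{1+}\cdots ,$$ and for $r>0$, $A_r:=R(e^{-2\pi\sqrt r})^{-5}-11-R(e^{-2\pi\sqrt r})^5$ (a positive number). For $r>0$, with $\sqrt{-r}=i\sqrt r$ and $\eta(\tau)=e^{\pi i\tau/12}\prod_{n\ge1}(1-e^{2\pi i n\tau})$, $$j_r:=\left[\left(\frac{\eta(\frac12\sqrt{-r})}{\eta(\sqrt{-r})}\right)^{16}+16\left(\frac{\eta(\sqrt{-r})}{\eta(\frac12\sqrt{-r})}\right)^{8}\right]^3 .$$ *)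

theory Defs
  imports "HOL-Analysis.Analysis"
begin

text \<open>
  \<open>rr_tail q k n\<close> is the finite continued fraction
  \<open>1 + q^k / (1 + q^(k+1) / (\<dots> / (1 + q^(k+n-1))))\<close> with \<open>n\<close> partial quotients.
\<close>

fun rr_tail :: "real \<Rightarrow> nat \<Rightarrow> nat \<Rightarrow> real" where
  "rr_tail q k 0 = 1"
| "rr_tail q k (Suc n) = 1 + q ^ k / rr_tail q (Suc k) n"

definition rr_convergent :: "real \<Rightarrow> nat \<Rightarrow> real" where
  "rr_convergent q n = q powr (1/5) / rr_tail q 1 n"

text \<open>
  The convergents do converge for \<open>0 < q < 1\<close> (\<open>rr_convergent_LIMSEQ\<close> below),
  so the use of \<open>lim\<close> is meaningful there.
\<close>

definition rogers_ramanujan :: "real \<Rightarrow> real" where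
  "rogers_ramanujan q = lim (rr_convergent q)"

lemma rr_tail_ge_1: "q > 0 \<Longrightarrow> rr_tail q k n \<ge> 1"
proof (induction n arbitrary: k)
  case (Suc n)
  then have "rr_tail q (Suc k) n \<ge> 1" by blast
  then show ?case using Suc.prems by simp
qed simp

lemma rr_tail_diff:
  assumes "0 < q" "q < 1"
  shows "\<bar>rr_tail q (Suc k) (Suc n) - rr_tail q (Suc k) n\<bar> \<le> q ^ Suc n"
proof (induction n arbitrary: k)
  case 0
  have "q * q ^ k \<le> q * 1"
    using assms by (intro mult_left_mono power_le_one) auto
  then show ?case using assms by simp
next
  case (Suc n)
  define x where "x = rr_tail q (Suc (Suc k)) (Suc n)"
  define y where "y = rr_tail q (Suc (Suc k)) n"
  have xy: "x \<ge> 1" "y \<ge> 1"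
    unfolding x_def y_def using assms(1) by (auto intro: rr_tail_ge_1 simp del: rr_tail.simps)
  have IH: "\<bar>x - y\<bar> \<le> q ^ Suc n" unfolding x_def y_def by (rule Suc.IH)
  have xy1: "x * y \<ge> 1" using mult_mono[of 1 x 1 y] xy by simp
  have "rr_tail q (Suc k) (Suc (Suc n)) - rr_tail q (Suc k) (Suc n) = q ^ Suc k * (y - x) / (x * y)"
    using xy unfolding rr_tail.simps(2)[of q "Suc k"] x_def[symmetric] y_def[symmetric]
    by (simp add: field_simps)
  then have "\<bar>rr_tail q (Suc k) (Suc (Suc n)) - rr_tail q (Suc k) (Suc n)\<bar>
      = q ^ Suc k * \<bar>x - y\<bar> / (x * y)"
    using assms xy by (simp add: abs_mult abs_minus_commute)
  also have "\<dots> \<le> q ^ Suc k * \<bar>x - y\<bar> / 1"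
    using assms xy1 by (intro divide_left_mono) auto
  also have "\<dots> \<le> q ^ 1 * q ^ Suc n"
    unfolding div_by_1 using assms IH by (intro mult_mono power_decreasing) auto
  finally show ?case by simp
qed

lemma rr_convergent_LIMSEQ:
  assumes "0 < q" "q < 1"
  shows "rr_convergent q \<longlonglongrightarrow> rogers_ramanujan q"
proof -
  have "summable (\<lambda>n. q ^ Suc n)"
    using assms by (simp add: summable_geometric summable_mult)
  then have "summable (\<lambda>n. rr_tail q 1 (Suc n) - rr_tail q 1 n)"
    by (rule summable_comparison_test')
      (use rr_tail_diff[OF assms, of 0] in \<open>simp del: rr_tail.simps\<close>)
  then have "convergent (\<lambda>n. \<Sum>i<n. rr_tail q 1 (Suc i) - rr_tail q 1 i)"
    by (simp only: summable_iff_convergent)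
  then have "convergent (\<lambda>n. rr_tail q 1 n - 1)"
    by (simp only: sum_lessThan_telescope rr_tail.simps(1))
  then obtain L where "(\<lambda>n. rr_tail q 1 n - 1) \<longlonglongrightarrow> L"
    by (auto simp: convergent_def)
  then have "(\<lambda>n. rr_tail q 1 n - 1 + 1) \<longlonglongrightarrow> L + 1"
    by (intro tendsto_intros)
  then have L: "rr_tail q 1 \<longlonglongrightarrow> L + 1" by simp
  have "L + 1 \<ge> 1"
    by (rule LIMSEQ_le_const[OF L]) (use rr_tail_ge_1[OF assms(1)] in blast)
  then have "(\<lambda>n. q powr (1/5) / rr_tail q 1 n) \<longlonglongrightarrow> q powr (1/5) / (L + 1)"
    by (intro tendsto_divide tendsto_const L) auto
  then have "convergent (rr_convergent q)"
    unfolding rr_convergent_def convergent_def by blast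
  then show ?thesis
    unfolding rogers_ramanujan_def by (simp add: convergent_LIMSEQ_iff)
qed

definition A_val :: "real \<Rightarrow> real" where
  "A_val r = rogers_ramanujan (exp (- 2 * pi * sqrt r)) powi (-5) - 11
           - rogers_ramanujan (exp (- 2 * pi * sqrt r)) ^ 5"

text \<open>The product is over \<open>n \<ge> 1\<close>, hence the shift to \<open>Suc n\<close>.\<close>

definition dedekind_eta :: "complex \<Rightarrow> complex" where
  "dedekind_eta \<tau> = exp (of_real pi * \<i> * \<tau> / 12) *
     (\<Prod>n. 1 - exp (2 * of_real pi * \<i> * of_nat (Suc n) * \<tau>))"

definition j_val :: "real \<Rightarrow> complex" where
  "j_val r = (let \<tau> = \<i> * of_real (sqrt r) in
     ((dedekind_eta (\<tau> / 2) / dedekind_eta \<tau>) ^ 16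
      + 16 * (dedekind_eta \<tau> / dedekind_eta (\<tau> / 2)) ^ 8) ^ 3)"

end

theory Submission
  imports Defs "HOL-Library.Nat_Bijection"
begin

text \<open>
  Put \<open>x = exp (- pi sqrt r)\<close> and \<open>f\<^sub>d = \<Prod>(1 - x\<^bsup>dn\<^esup>)\<close>. Everything is a rational function of the Hauptmodul
  \<open>w = f\<^sub>2 f\<^sub>5\<^sup>5 / (x f\<^sub>1 f\<^bsub>10\<^esub>\<^sup>5)\<close> of \<open>\<Gamma>\<^sub>0(10)\<close>, whose shifts \<open>w + 1\<close> and \<open>w - 4\<close> are again eta quotients:
  the first by Weierstrass' three-term relation between theta functions to the base \<open>x\<^bsup>10\<^esup>\<close>, the second by
  sorting a theta series over \<open>\<int>\<^sup>2\<close> into classes modulo 5. Hence \<open>j\<^sub>r\<close>, a function of \<open>f\<^sub>1 / f\<^sub>2\<close>, is rational in \<open>w\<close>.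
  Rogers' series turn the continued fraction into a quotient of theta functions, and the three-term relation
  expresses it through \<open>k\<close> with \<open>w = 1 / k - k\<close>, so that \<open>A\<^sub>r = (w + 1)\<^sup>2 (w - 4) / w\<close>. Eliminating \<open>w\<close> yields
  \<open>j\<^sub>r = (A\<^sub>r\<^sup>2 + 250 A\<^sub>r + 3125)\<^sup>3 / A\<^sub>r\<^sup>5\<close>. By continuity \<open>A\<^sub>r\<close> takes every positive value, and the two
  formulas of the theorem parametrise this curve.
\<close>

section \<open>The q-Pochhammer symbol\<close>

text \<open>Why level ten: with \<open>tau = i * sqrt r\<close>, \<open>j_r\<close> is the modular
  invariant j(tau) written through Weber's function eta(tau/2)/eta(tau), while \<open>A_r\<close> is
  (eta(tau)/eta(5 tau))^6. In the variable tau/2, whose nome is \<open>x\<close>, both live on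
  Gamma_0(10), which has genus 0, so each is rational in one function, and j itself never has to be
  expanded. The constants are forced: at the four cusps \<open>w\<close> takes the values infinity,
  0, -1 and 4, so functions without zeros and poles elsewhere are monomials in \<open>w\<close>,
  \<open>w + 1\<close>, \<open>w - 4\<close>. The degrees 3 and 6 of \<open>A_r\<close> and of the
  24th power of Weber's function are the indices of Gamma_0(10) in the groups of level 5 and level
  2. No modularity is used; each relation is proved by theta series. The other obstacle is analytic,
  since R is only given as a limit of convergents. The recurrence of Rogers' series supplies an
  error bound \<open>q ^ n\<close>, which both identifies the limit and makes the convergence
  uniform, hence R continuous.\<close>

definition qpoch :: "'a::{real_normed_field,banach} \<Rightarrow> 'a \<Rightarrow> 'a" where
  "qpoch z q = (\<Prod>n. 1 - z * q ^ n)"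

lemma convergent_prod_qpoch:
  fixes z q :: "'a::{real_normed_field,banach}"
  assumes "norm q < 1"
  shows "convergent_prod (\<lambda>n. 1 - z * q ^ n)"
proof (intro abs_convergent_prod_imp_convergent_prod summable_imp_abs_convergent_prod)
  show "summable (\<lambda>i. norm (1 - z * q ^ i - 1))"
    using assms by (simp add: norm_mult norm_power summable_mult)
qed

lemma qpoch_LIMSEQ:
  fixes z q :: "'a::{real_normed_field,banach}"
  assumes "norm q < 1"
  shows "(\<lambda>n. \<Prod>i<n. 1 - z * q ^ i) \<longlonglongrightarrow> qpoch z q"
  using convergent_prod_LIMSEQ[OF convergent_prod_qpoch[OF assms]]
  unfolding qpoch_def using LIMSEQ_lessThan_iff_atMost by blast

lemma qpoch_nonzeroI:
  fixes z q :: "'a::{real_normed_field,banach}"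
  assumes "norm q < 1" "\<And>n. z * q ^ n \<noteq> 1"
  shows "qpoch z q \<noteq> 0"
  unfolding qpoch_def
  by (rule prodinf_nonzero[OF convergent_prod_qpoch[OF assms(1)]]) (use assms(2) in auto)

lemma qpoch_nonzero:
  fixes z q :: "'a::{real_normed_field,banach}"
  assumes "norm q < 1" "norm z < 1"
  shows "qpoch z q \<noteq> 0"
proof (rule qpoch_nonzeroI[OF assms(1)])
  fix n
  have "norm (z * q ^ n) \<le> norm z * 1"
    unfolding norm_mult norm_power using assms(1) by (intro mult_left_mono power_le_one) auto
  then show "z * q ^ n \<noteq> 1" using assms(2) by auto
qed

lemma qpoch_unfold:
  fixes z q :: "'a::{real_normed_field,banach}"
  assumes "norm q < 1"
  shows "qpoch z q = (1 - z) * qpoch (z * q) q"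
proof (rule LIMSEQ_unique)
  show "(\<lambda>n. \<Prod>i<Suc n. 1 - z * q ^ i) \<longlonglongrightarrow> qpoch z q"
    using qpoch_LIMSEQ[OF assms] by (rule LIMSEQ_Suc)
  have "(\<lambda>n. (1 - z) * (\<Prod>i<n. 1 - z * q * q ^ i)) \<longlonglongrightarrow> (1 - z) * qpoch (z * q) q"
    by (intro tendsto_intros qpoch_LIMSEQ assms)
  then show "(\<lambda>n. \<Prod>i<Suc n. 1 - z * q ^ i) \<longlonglongrightarrow> (1 - z) * qpoch (z * q) q"
    by (subst prod.lessThan_Suc_shift) (simp add: mult.assoc)
qed

text \<open>The factors are sorted by the residue of the exponent modulo \<open>k\<close>. For
  partial products of length \<open>n * k\<close> this is an exchange of finite products, and such a
  subsequence determines the limit.\<close>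

lemma qpoch_group:
  fixes z q :: "'a::{real_normed_field,banach}"
  assumes "norm q < 1" "k > 0"
  shows "qpoch z q = (\<Prod>i<k. qpoch (z * q ^ i) (q ^ k))"
proof (rule LIMSEQ_unique)
  have *: "norm (q ^ k) < 1"
    using assms by (simp add: norm_power power_less_one_iff)
  have "(\<lambda>n. \<Prod>i<k. \<Prod>m<n. 1 - z * q ^ i * (q ^ k) ^ m) \<longlonglongrightarrow> (\<Prod>i<k. qpoch (z * q ^ i) (q ^ k))"
    by (intro tendsto_prod qpoch_LIMSEQ *)
  moreover have "(\<Prod>i<k. \<Prod>m<n. 1 - z * q ^ i * (q ^ k) ^ m) = (\<Prod>i<n * k. 1 - z * q ^ i)" for n
  proof -
    have "(\<Prod>i<n * k. 1 - z * q ^ i) = (\<Prod>m<n. \<Prod>i=m*k..<m*k+k. 1 - z * q ^ i)"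
      by (rule prod.nat_group[symmetric])
    also have "\<dots> = (\<Prod>m<n. \<Prod>i<k. 1 - z * q ^ i * (q ^ k) ^ m)"
    proof (rule prod.cong[OF refl])
      fix m
      show "(\<Prod>i=m*k..<m*k+k. 1 - z * q ^ i) = (\<Prod>i<k. 1 - z * q ^ i * (q ^ k) ^ m)"
        using prod.shift_bounds_nat_ivl[of "\<lambda>i. 1 - z * q ^ i" 0 "m*k" k]
        by (simp add: atLeast0LessThan add.commute power_add power_mult mult.assoc mult.commute)
    qed
    also have "\<dots> = (\<Prod>i<k. \<Prod>m<n. 1 - z * q ^ i * (q ^ k) ^ m)"
      by (rule prod.swap)
    finally show ?thesis ..
  qed
  ultimately show "(\<lambda>n. \<Prod>i<n * k. 1 - z * q ^ i) \<longlonglongrightarrow> (\<Prod>i<k. qpoch (z * q ^ i) (q ^ k))"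
    by simp
  show "(\<lambda>n. \<Prod>i<n * k. 1 - z * q ^ i) \<longlonglongrightarrow> qpoch z q"
    using assms(2) by (intro filterlim_compose[OF qpoch_LIMSEQ[OF assms(1)]] mult_nat_right_at_top)
qed

text \<open>Assuming a factorisation of \<open>1 - y ^ k\<close> instead of naming the roots lets
  one statement serve \<open>k = 2\<close> in any field and \<open>k = 5\<close> over the complex
  numbers.\<close>

lemma qpoch_roots_of_unity:
  fixes z q :: "'a::{real_normed_field,banach}"
  assumes "norm q < 1" "k > 0" "\<And>y. (\<Prod>i\<in>I. 1 - w i * y) = 1 - y ^ k"
  shows "(\<Prod>i\<in>I. qpoch (w i * z) q) = qpoch (z ^ k) (q ^ k)"
proof (rule LIMSEQ_unique)
  have *: "norm (q ^ k) < 1"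
    using assms by (simp add: norm_power power_less_one_iff)
  show "(\<lambda>n. \<Prod>i\<in>I. \<Prod>m<n. 1 - w i * z * q ^ m) \<longlonglongrightarrow> (\<Prod>i\<in>I. qpoch (w i * z) q)"
    by (intro tendsto_prod qpoch_LIMSEQ assms(1))
  have "(\<Prod>i\<in>I. \<Prod>m<n. 1 - w i * z * q ^ m) = (\<Prod>m<n. 1 - z ^ k * (q ^ k) ^ m)" for n
  proof -
    have "(\<Prod>i\<in>I. 1 - w i * z * q ^ m) = 1 - z ^ k * (q ^ k) ^ m" for m
      using assms(3)[of "z * q ^ m"] by (simp add: mult.assoc power_mult_distrib power_commutes mult.commute[of m] flip: power_mult)
    then show ?thesis by (subst prod.swap) simp
  qed
  then show "(\<lambda>n. \<Prod>i\<in>I. \<Prod>m<n. 1 - w i * z * q ^ m) \<longlonglongrightarrow> qpoch (z ^ k) (q ^ k)"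
    using qpoch_LIMSEQ[OF *] by simp
qed

lemma qpoch_of_real:
  fixes z q :: real
  assumes "norm q < 1"
  shows "qpoch (of_real z) (of_real q) = (of_real (qpoch z q) :: 'a::{real_normed_field,banach})"
proof -
  have "(\<lambda>n. of_real (1 - z * q ^ n) :: 'a) has_prod of_real (qpoch z q)"
    unfolding has_prod_of_real_iff qpoch_def
    using convergent_prod_qpoch[OF assms] by blast
  then show ?thesis unfolding qpoch_def by (simp add: has_prod_iff)
qed

section \<open>Gaussian binomial coefficients and the triple product\<close>

text \<open>A Pascal rule serves as definition, so that no denominator \<open>1 - q ^ i\<close>
  occurs. For \<open>k > n\<close> the subtraction \<open>n - k\<close> truncates, but the
  coefficient that it multiplies is 0.\<close>

fun gauss_binomial :: "'a::comm_ring_1 \<Rightarrow> nat \<Rightarrow> nat \<Rightarrow> 'a" where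
  "gauss_binomial q n 0 = 1"
| "gauss_binomial q 0 (Suc k) = 0"
| "gauss_binomial q (Suc n) (Suc k) = gauss_binomial q n (Suc k) + q ^ (n - k) * gauss_binomial q n k"

lemma gauss_binomial_eq_0: "n < k \<Longrightarrow> gauss_binomial q n k = 0"
  by (induction q n k rule: gauss_binomial.induct) auto

lemma gauss_binomial_closed:
  "k \<le> n \<Longrightarrow> gauss_binomial q n k * (\<Prod>i<k. 1 - q ^ Suc i) * (\<Prod>i<n-k. 1 - q ^ Suc i) = (\<Prod>i<n. 1 - q ^ Suc i)"
proof (induction n arbitrary: k)
  case (Suc n)
  show ?case
  proof (cases k)
    case (Suc j)
    let ?P = "\<lambda>n. \<Prod>i<n. 1 - q ^ Suc i"
    from Suc Suc.prems have "j \<le> n" by simp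
    then have 1: "gauss_binomial q n j * ?P j * ?P (n - j) = ?P n" by (rule Suc.IH)
    show ?thesis
    proof (cases "j = n")
      case True
      have "gauss_binomial q n n * ?P n = ?P n" using Suc.IH[of n] by simp
      then have "gauss_binomial q n n * (?P n * (1 - q ^ Suc n)) = ?P n * (1 - q ^ Suc n)"
        by (metis mult.assoc)
      moreover have "gauss_binomial q (Suc n) (Suc n) = gauss_binomial q n n"
        by (simp add: gauss_binomial_eq_0)
      ultimately show ?thesis
        unfolding Suc True by (simp only: prod.lessThan_Suc diff_self_eq_0 lessThan_0 prod.empty mult_1_right)
    next
      case False
      then obtain m where m: "n = Suc (j + m)"
        using \<open>j \<le> n\<close> less_iff_Suc_add[of j n] by auto
      have 2: "gauss_binomial q n (Suc j) * ?P (Suc j) * ?P (n - Suc j) = ?P n"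
        using Suc.IH[of "Suc j"] m by simp
      have e: "n - j = Suc m" "n - Suc j = m" "Suc n - Suc j = Suc m" using m by auto
      have "gauss_binomial q (Suc n) (Suc j) * ?P (Suc j) * ?P (Suc m)
         = (gauss_binomial q n (Suc j) * ?P (Suc j) * ?P m) * (1 - q ^ Suc m)
         + q ^ Suc m * (gauss_binomial q n j * ?P j * ?P (Suc m)) * (1 - q ^ Suc j)"
        using e by (simp add: algebra_simps)
      also have "\<dots> = ?P n * (1 - q ^ Suc m) + q ^ Suc m * ?P n * (1 - q ^ Suc j)"
        using 1 2 unfolding e by (simp only:)
      also have "\<dots> = ?P n * (1 - q ^ Suc m * q ^ Suc j)" by (simp add: algebra_simps)
      also have "q ^ Suc m * q ^ Suc j = q ^ Suc n" using m by (simp add: power_add ac_simps)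
      finally show ?thesis using Suc e by simp
    qed
  qed simp
qed simp

lemma q_binomial_theorem:
  fixes z q :: "'a::comm_ring_1"
  shows "(\<Prod>i<n. 1 + z * q ^ i) = (\<Sum>k\<le>n. q ^ (k choose 2) * gauss_binomial q n k * z ^ k)"
proof (induction n)
  case (Suc n)
  have e0: "q ^ (0 choose 2) = 1" by (subst binomial_eq_0) auto
  let ?t = "\<lambda>n k. q ^ (k choose 2) * gauss_binomial q n k * z ^ k"
  have step: "?t (Suc n) (Suc k) = ?t n (Suc k) + z * q ^ n * ?t n k" if "k \<le> n" for k
  proof -
    have "q ^ (Suc k choose 2) * q ^ (n - k) = q ^ (k choose 2) * q ^ n"
      using that by (simp add: numeral_2_eq_2 flip: power_add)
    then have "q ^ (Suc k choose 2) * (q ^ (n - k) * gauss_binomial q n k) * z ^ Suc k = z * q ^ n * ?t n k"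
      by (simp add: algebra_simps)
    then show ?thesis by (simp add: algebra_simps)
  qed
  have "(\<Sum>k\<le>Suc n. ?t (Suc n) k) = 1 + (\<Sum>k\<le>n. ?t (Suc n) (Suc k))"
    by (subst sum.atMost_Suc_shift) (simp add: e0)
  also have "(\<Sum>k\<le>n. ?t (Suc n) (Suc k)) = (\<Sum>k\<le>n. ?t n (Suc k) + z * q ^ n * ?t n k)"
    by (intro sum.cong refl step) simp
  also have "\<dots> = (\<Sum>k\<le>n. ?t n (Suc k)) + z * q ^ n * (\<Sum>k\<le>n. ?t n k)"
    by (simp only: sum.distrib sum_distrib_left)
  also have "1 + ((\<Sum>k\<le>n. ?t n (Suc k)) + z * q ^ n * (\<Sum>k\<le>n. ?t n k))
      = (\<Sum>k\<le>Suc n. ?t n k) + z * q ^ n * (\<Sum>k\<le>n. ?t n k)"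
    by (subst sum.atMost_Suc_shift) (simp add: e0)
  also have "(\<Sum>k\<le>Suc n. ?t n k) = (\<Sum>k\<le>n. ?t n k)" by (simp add: gauss_binomial_eq_0)
  finally show ?case using Suc.IH by (simp add: algebra_simps)
next
  case 0
  have "q ^ (0 choose 2) = 1" by (subst binomial_eq_0) auto
  then show ?case by simp
qed

section \<open>Theta series and Jacobi's triple product\<close>

definition tri :: "int \<Rightarrow> int" where "tri n = n * (n - 1) div 2"

lemma eq_if_double_eq: "2 * a = 2 * b \<Longrightarrow> a = b" for a b :: int
  by simp

lemma two_tri: "2 * tri n = n * (n - 1)"
  unfolding tri_def by simp

lemma tri_int: "tri (int n) = int (n choose 2)"
proof -
  have "even (n * (n - 1))" by (cases n) auto
  then have "2 * int (n choose 2) = int (n * (n - 1))"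
    unfolding choose_two by (metis dvd_mult_div_cancel of_nat_mult of_nat_numeral)
  also have "\<dots> = 2 * tri (int n)"
    unfolding two_tri by (cases n) (auto simp: algebra_simps)
  finally show ?thesis by simp
qed

text \<open>In this normalisation the zeros lie at \<open>z = - (q powi m)\<close>, which is why
  theta values are later taken at negated arguments.\<close>

definition jtheta :: "'a::{real_normed_field,banach} \<Rightarrow> 'a \<Rightarrow> 'a" where
  "jtheta z q = (\<Sum>\<^sub>\<infinity>n. z powi n * q powi tri n)"

lemma summable_power_choose_two:
  fixes r s :: real
  assumes "r > 0" "0 < s" "s < 1"
  shows "summable (\<lambda>n. r ^ n * s ^ (n choose 2))"
proof -
  have "(\<lambda>n. r * s ^ n) \<longlonglongrightarrow> r * 0"
    using assms by (intro tendsto_intros LIMSEQ_realpow_zero) auto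
  then have "\<forall>\<^sub>F n in sequentially. r * s ^ n < 1/2"
    by (rule order_tendstoD) simp
  then obtain N where N: "\<And>n. n \<ge> N \<Longrightarrow> r * s ^ n < 1/2"
    unfolding eventually_sequentially by blast
  show ?thesis
  proof (rule summable_ratio_test[of "1/2" N])
    fix n assume "n \<ge> N"
    have "norm (r ^ Suc n * s ^ (Suc n choose 2)) = (r * s ^ n) * norm (r ^ n * s ^ (n choose 2))"
      using assms by (simp add: numeral_2_eq_2 power_add abs_mult)
    also have "\<dots> \<le> 1/2 * norm (r ^ n * s ^ (n choose 2))"
      using N[OF \<open>n \<ge> N\<close>] by (intro mult_right_mono) auto
    finally show "norm (r ^ Suc n * s ^ (Suc n choose 2)) \<le> 1/2 * norm (r ^ n * s ^ (n choose 2))" .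
  qed simp
qed

text \<open>The sum splits at 0. As \<open>tri (- m) = tri m + m\<close>, the negative half is a
  series of the same kind with \<open>r\<close> replaced by \<open>s / r\<close>.\<close>

lemma jtheta_abs_summable:
  fixes z q :: "'a::{real_normed_field,banach}"
  assumes "z \<noteq> 0" "q \<noteq> 0" "norm q < 1"
  shows "(\<lambda>n. norm (z powi n * q powi tri n)) summable_on UNIV"
proof -
  define r where "r = norm z"
  define s where "s = norm q"
  have rs: "r > 0" "s > 0" "s < 1" using assms by (auto simp: r_def s_def)
  have norm: "norm (z powi n * q powi tri n) = r powi n * s powi tri n" for n
    by (simp add: norm_mult norm_power_int r_def s_def)
  have 1: "(\<lambda>n. r powi n * s powi tri n) summable_on range int"
    by (subst summable_on_reindex)
      (use rs in \<open>auto simp: o_def tri_int power_int_of_nat summable_on_UNIV_nonneg_real_iff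
        intro!: summable_power_choose_two\<close>)
  have tri_neg: "tri (- int (Suc n)) = int (Suc n choose 2) + int (Suc n)" for n
  proof -
    have "2 * tri (- int (Suc n)) = 2 * (tri (int (Suc n)) + int (Suc n))"
      unfolding distrib_left two_tri by (simp add: algebra_simps)
    then show ?thesis unfolding tri_int by (rule eq_if_double_eq)
  qed
  have e: "r powi (- int (Suc n)) * s powi tri (- int (Suc n))
      = (s / r) ^ Suc n * s ^ (Suc n choose 2)" for n
    unfolding tri_neg using rs
    by (simp add: power_int_minus power_int_of_nat power_int_add power_divide field_simps del: of_nat_Suc power_Suc)
  have "summable (\<lambda>n. (s / r) ^ Suc n * s ^ (Suc n choose 2))"
    by (subst summable_Suc_iff) (use rs in \<open>auto intro!: summable_power_choose_two\<close>)
  then have 2: "(\<lambda>n. r powi n * s powi tri n) summable_on range (\<lambda>n. - int (Suc n))"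
    by (subst summable_on_reindex)
      (use rs in \<open>auto simp: o_def e summable_on_UNIV_nonneg_real_iff inj_on_def
         simp del: of_nat_Suc power_Suc\<close>)
  have "range int \<inter> range (\<lambda>n. - int (Suc n)) = {}" by auto
  moreover have "(UNIV :: int set) = range int \<union> range (\<lambda>n. - int (Suc n))"
  proof -
    have "x \<in> range int \<union> range (\<lambda>n. - int (Suc n))" for x
      by (cases x rule: int_cases) (auto simp: image_iff)
    then show ?thesis by blast
  qed
  ultimately show ?thesis
    unfolding norm using summable_on_Un_disjoint[OF 1 2] by simp
qed

text \<open>The q-binomial theorem with \<open>2 * n\<close> factors is applied at
  \<open>z / q ^ n\<close>, which centres the exponents: the first \<open>n\<close> factors, read
  backwards, become \<open>1 + q ^ Suc i / z\<close> up to monomials.\<close>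

lemma finite_triple_product:
  fixes z q :: "'a::field"
  assumes "z \<noteq> 0" "q \<noteq> 0"
  shows "(\<Prod>i<n. (1 + z * q ^ i) * (1 + q ^ Suc i / z))
    = (\<Sum>j\<in>{- int n..int n}. z powi j * q powi tri j * gauss_binomial q (2 * n) (nat (int n + j)))"
proof -
  define w where "w = z / q ^ n"
  have "(\<Prod>i<2*n. 1 + w * q ^ i) = (\<Prod>i<n. 1 + w * q ^ i) * (\<Prod>i<n. 1 + w * q ^ (i + n))"
  proof -
    have "(\<Prod>i<n+n. 1 + w * q ^ i) = (\<Prod>i<n. 1 + w * q ^ i) * (\<Prod>i=n..<n+n. 1 + w * q ^ i)"
      by (metis atLeast0LessThan le_add1 prod.atLeastLessThan_concat zero_le)
    also have "(\<Prod>i=n..<n+n. 1 + w * q ^ i) = (\<Prod>i<n. 1 + w * q ^ (i + n))"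
      using prod.shift_bounds_nat_ivl[of "\<lambda>i. 1 + w * q ^ i" 0 n n] by (simp add: atLeast0LessThan)
    finally show ?thesis by (simp add: mult_2)
  qed
  also have "(\<Prod>i<n. 1 + w * q ^ (i + n)) = (\<Prod>i<n. 1 + z * q ^ i)"
    using assms by (simp add: w_def power_add)
  also have "(\<Prod>i<n. 1 + w * q ^ i) = (\<Prod>i<n. 1 + w * q ^ (n - Suc i))"
    by (rule prod.nat_diff_reindex[symmetric])
  also have "\<dots> = (\<Prod>i<n. z / q ^ Suc i * (1 + q ^ Suc i / z))"
  proof (rule prod.cong[OF refl])
    fix i assume "i \<in> {..<n}"
    then have "q ^ n = q ^ (n - Suc i) * q ^ Suc i"
      using power_add[of q "n - Suc i" "Suc i"] by simp
    then show "1 + w * q ^ (n - Suc i) = z / q ^ Suc i * (1 + q ^ Suc i / z)"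
      using assms by (simp add: w_def field_simps)
  qed
  also have "\<dots> = (\<Prod>i<n. z / q ^ Suc i) * (\<Prod>i<n. 1 + q ^ Suc i / z)"
    by (rule prod.distrib)
  also have "(\<Prod>i<n. z / q ^ Suc i) = z ^ n / q ^ (Suc n choose 2)"
    by (induction n) (auto simp: numeral_2_eq_2 power_add field_simps)
  finally have "(\<Prod>i<n. (1 + z * q ^ i) * (1 + q ^ Suc i / z))
     = q ^ (Suc n choose 2) / z ^ n * (\<Prod>i<2*n. 1 + w * q ^ i)"
    unfolding prod.distrib using assms by simp
  also have "\<dots> = (\<Sum>k\<le>2*n. q ^ (Suc n choose 2) / z ^ n * (q ^ (k choose 2) * gauss_binomial q (2*n) k * w ^ k))"
    unfolding q_binomial_theorem sum_distrib_left ..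
  also have "\<dots> = (\<Sum>j\<in>{- int n..int n}. z powi j * q powi tri j * gauss_binomial q (2 * n) (nat (int n + j)))"
  proof (rule sum.reindex_bij_witness[of _ "\<lambda>j. nat (int n + j)" "\<lambda>k. int k - int n"])
    fix k assume "k \<in> {..2*n}"
    define j where "j = int k - int n"
    have "2 * (int (Suc n choose 2) + int (k choose 2)) = 2 * (tri j + int n * int k)"
      unfolding distrib_left two_tri tri_int[symmetric] by (simp add: j_def algebra_simps)
    then have "int (Suc n choose 2) + int (k choose 2) = tri j + int n * int k"
      by (rule eq_if_double_eq)
    then have "q powi (int (Suc n choose 2) + int (k choose 2)) = q powi (tri j + int (n * k))" by simp
    then have 1: "q ^ (Suc n choose 2) * q ^ (k choose 2) = q powi tri j * q ^ (n * k)"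
      using assms by (simp only: power_int_add power_int_of_nat simp_thms)
    have "z powi j * z ^ n = z ^ k"
      using assms power_int_add[of z j "int n"] by (simp add: j_def power_int_of_nat)
    then have 2: "z powi j = z ^ k / z ^ n" using assms by (simp add: field_simps)
    have 3: "q powi tri j = q ^ (Suc n choose 2) * q ^ (k choose 2) / q ^ (n * k)"
      using 1 assms by (simp add: field_simps)
    show "z powi (int k - int n) * q powi tri (int k - int n) * gauss_binomial q (2 * n) (nat (int n + (int k - int n)))
      = q ^ (Suc n choose 2) / z ^ n * (q ^ (k choose 2) * gauss_binomial q (2*n) k * w ^ k)"
      unfolding j_def[symmetric] 2 3 unfolding j_def using assms
      by (simp add: w_def power_divide power_mult)
  qed auto
  finally show ?thesis .
qed

lemma prod_one_minus_power_nonzero: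
  fixes q :: "'a::real_normed_field"
  assumes "norm q < 1"
  shows "(\<Prod>i<n. 1 - q ^ Suc i) \<noteq> 0"
proof -
  have "q ^ Suc i \<noteq> 1" for i
    using assms power_less_one_iff[of "norm q" "Suc i"]
    by (metis less_irrefl nat.distinct(1) norm_ge_zero norm_one norm_power zero_less_Suc)
  then show ?thesis by (auto simp del: power_Suc)
qed

lemma tendsto_gauss_binomial:
  fixes q :: "'a::{real_normed_field,banach}"
  assumes "norm q < 1"
  shows "(\<lambda>n. gauss_binomial q (2 * n) (nat (int n + j))) \<longlonglongrightarrow> 1 / qpoch q q"
proof -
  define P where "P n = (\<Prod>i<n. 1 - q ^ Suc i)" for n
  have P: "P \<longlonglongrightarrow> qpoch q q"
    unfolding P_def using qpoch_LIMSEQ[OF assms, of q] by simp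
  have nz: "qpoch q q \<noteq> 0" by (rule qpoch_nonzero) (use assms in auto)
  have Pnz: "P n \<noteq> 0" for n
    unfolding P_def by (rule prod_one_minus_power_nonzero[OF assms])
  have lim1: "filterlim (\<lambda>n. 2 * n :: nat) at_top sequentially"
    by (rule filterlim_subseq) (auto simp: strict_mono_def)
  have lim2: "filterlim (\<lambda>n. nat (int n + i)) at_top sequentially" for i
    unfolding filterlim_at_top eventually_sequentially
  proof (intro allI exI impI)
    fix Z n assume "n \<ge> nat (int Z - i)"
    then show "Z \<le> nat (int n + i)" by linarith
  qed
  have "(\<lambda>n. P (2 * n) / (P (nat (int n + j)) * P (nat (int n + (- j))))) \<longlonglongrightarrow> qpoch q q / (qpoch q q * qpoch q q)"
    using nz by (intro tendsto_intros filterlim_compose[OF P] lim1 lim2) auto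
  moreover have "\<forall>\<^sub>F n in sequentially. P (2 * n) / (P (nat (int n + j)) * P (nat (int n + (- j))))
      = gauss_binomial q (2 * n) (nat (int n + j))"
    unfolding eventually_sequentially
  proof (intro exI allI impI)
    fix n assume "n \<ge> nat \<bar>j\<bar>"
    then have a: "nat (int n + j) \<le> 2 * n" "2 * n - nat (int n + j) = nat (int n + (- j))" by linarith+
    show "P (2 * n) / (P (nat (int n + j)) * P (nat (int n + (- j)))) = gauss_binomial q (2 * n) (nat (int n + j))"
      using gauss_binomial_closed[OF a(1), of q] Pnz unfolding P_def[symmetric] a(2)
      by (simp add: field_simps)
  qed
  ultimately show ?thesis
    using nz by (auto intro: Lim_transform_eventually)
qed

text \<open>Uniformity in both \<open>n\<close> and \<open>k\<close> provides the majorant for the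
  termwise limit in the triple product.\<close>

lemma gauss_binomial_bounded:
  fixes q :: "'a::{real_normed_field,banach}"
  assumes "norm q < 1"
  obtains C where "C > 0" "\<And>n k. norm (gauss_binomial q n k) \<le> C"
proof -
  define P where "P n = (\<Prod>i<n. 1 - q ^ Suc i)" for n
  have P: "P \<longlonglongrightarrow> qpoch q q"
    unfolding P_def using qpoch_LIMSEQ[OF assms, of q] by simp
  have nz: "qpoch q q \<noteq> 0" by (rule qpoch_nonzero) (use assms in auto)
  have Pnz: "P n \<noteq> 0" for n
    unfolding P_def by (rule prod_one_minus_power_nonzero[OF assms])
  obtain B where B: "B > 0" "\<And>n. norm (P n) \<le> B"
    using convergent_imp_Bseq[OF convergentI[OF P]] unfolding Bseq_def by blast
  obtain D where D: "D > 0" "\<And>n. norm (inverse (P n)) \<le> D"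
    using convergent_imp_Bseq[OF convergentI[OF tendsto_inverse[OF P nz]]] unfolding Bseq_def by blast
  have "norm (gauss_binomial q n k) \<le> B * D * D" for n k
  proof (cases "k \<le> n")
    case True
    have "gauss_binomial q n k = P n * inverse (P k) * inverse (P (n - k))"
      using gauss_binomial_closed[OF True, of q] Pnz unfolding P_def[symmetric]
      by (simp add: field_simps)
    then show ?thesis
      unfolding norm_mult using B D by (simp add: norm_mult mult_mono)
  next
    case False
    then show ?thesis using B D by (simp add: gauss_binomial_eq_0)
  qed
  then show thesis using that[of "B * D * D"] B D by simp
qed

lemma jacobi_triple_product:
  fixes z q :: "'a::{real_normed_field,banach}"
  assumes "z \<noteq> 0" "q \<noteq> 0" "norm q < 1"
  shows "jtheta z q = qpoch (- z) q * qpoch (- q / z) q * qpoch q q"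
proof -
  define f where "f j = z powi j * q powi tri j" for j
  \<comment> \<open>Terms outside the finite range are set to 0, and \<open>int_decode\<close>
    enumerates the integers; so all the finite sums become series over one index set and Tannery's
    theorem applies.\<close>
  define g where "g n j = (if \<bar>j\<bar> \<le> int n then f j * gauss_binomial q (2 * n) (nat (int n + j)) else 0)" for n j
  obtain C where C: "C > 0" "\<And>n k. norm (gauss_binomial q n k) \<le> C"
    using gauss_binomial_bounded[OF assms(3)] by blast
  have nz: "qpoch q q \<noteq> 0" by (rule qpoch_nonzero) (use assms in auto)
  have fs: "(\<lambda>j. norm (f j)) summable_on UNIV"
    unfolding f_def by (rule jtheta_abs_summable[OF assms])
  have f_has: "(f has_sum jtheta z q) UNIV"
    using fs abs_summable_summable unfolding f_def jtheta_def by fastforce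
  have fnorm: "summable (\<lambda>k. norm (f (int_decode k)))"
    using fs summable_on_reindex_bij_betw[OF bij_int_decode, of "\<lambda>j. norm (f j)"]
    by (simp add: summable_on_UNIV_nonneg_real_iff)
  have "(\<lambda>k. f (int_decode k)) sums jtheta z q"
    using f_has has_sum_reindex_bij_betw[OF bij_int_decode, of f] by (simp add: has_sum_imp_sums)
  then have fsum: "(\<Sum>k. f (int_decode k) / qpoch q q) = jtheta z q / qpoch q q"
    by (rule sums_unique[symmetric, OF sums_divide])
  have gsum: "(\<Sum>k. g n (int_decode k)) = (\<Prod>i<n. (1 + z * q ^ i) * (1 + q ^ Suc i / z))" for n
  proof -
    have "(g n has_sum (\<Sum>j\<in>{- int n..int n}. g n j)) UNIV"
      by (rule has_sum_finite_neutralI) (auto simp: g_def)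
    then have "(\<lambda>k. g n (int_decode k)) sums (\<Sum>j\<in>{- int n..int n}. g n j)"
      using has_sum_reindex_bij_betw[OF bij_int_decode, of "g n"] by (simp add: has_sum_imp_sums)
    then have "(\<Sum>k. g n (int_decode k)) = (\<Sum>j\<in>{- int n..int n}. g n j)"
      by (rule sums_unique[symmetric])
    also have "\<dots> = (\<Prod>i<n. (1 + z * q ^ i) * (1 + q ^ Suc i / z))"
      unfolding finite_triple_product[OF assms(1,2)]
      by (intro sum.cong) (auto simp: g_def f_def)
    finally show ?thesis .
  qed
  have "(\<lambda>n. \<Sum>k. g n (int_decode k)) \<longlonglongrightarrow> (\<Sum>k. f (int_decode k) / qpoch q q)"
  proof (rule tannerys_theorem[THEN conjunct2, THEN conjunct2])
    show "summable (\<lambda>k. C * norm (f (int_decode k)))"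
      using fnorm by (rule summable_mult)
    have "norm (g n (int_decode k)) \<le> C * norm (f (int_decode k))" for n k
      using C by (simp add: g_def norm_mult mult.commute[of C] mult_left_mono)
    then show "\<forall>\<^sub>F (k, n) in at_top \<times>\<^sub>F sequentially. norm (g n (int_decode k)) \<le> C * norm (f (int_decode k))"
      by (intro always_eventually) auto
  next
    fix k
    have ev: "\<forall>\<^sub>F n in sequentially. f (int_decode k) * gauss_binomial q (2 * n) (nat (int n + int_decode k)) = g n (int_decode k)"
      unfolding eventually_sequentially by (rule exI[of _ "nat \<bar>int_decode k\<bar>"]) (auto simp: g_def)
    show "(\<lambda>n. g n (int_decode k)) \<longlonglongrightarrow> f (int_decode k) / qpoch q q"
      by (rule Lim_transform_eventually[OF _ ev])
        (use tendsto_mult[OF tendsto_const tendsto_gauss_binomial[OF assms(3)], of "f (int_decode k)" "int_decode k"] in simp)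
  qed simp
  then have 1: "(\<lambda>n. \<Prod>i<n. (1 + z * q ^ i) * (1 + q ^ Suc i / z)) \<longlonglongrightarrow> jtheta z q / qpoch q q"
    unfolding fsum gsum .
  have "(\<lambda>n. (\<Prod>i<n. 1 - (- z) * q ^ i) * (\<Prod>i<n. 1 - (- q / z) * q ^ i)) \<longlonglongrightarrow> qpoch (- z) q * qpoch (- q / z) q"
    by (intro tendsto_mult qpoch_LIMSEQ assms)
  then have 2: "(\<lambda>n. \<Prod>i<n. (1 + z * q ^ i) * (1 + q ^ Suc i / z)) \<longlonglongrightarrow> qpoch (- z) q * qpoch (- q / z) q"
    by (simp add: prod.distrib)
  show ?thesis
    using LIMSEQ_unique[OF 1 2] nz by (simp add: field_simps)
qed

section \<open>The three-term relation\<close>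

lemma norm_summable_on_times:
  fixes f :: "'a \<Rightarrow> 'c::{real_normed_field,banach}" and g :: "'b \<Rightarrow> 'c"
  assumes "(\<lambda>x. norm (f x)) summable_on A" "(\<lambda>y. norm (g y)) summable_on B"
  shows "(\<lambda>p. norm (case p of (x, y) \<Rightarrow> f x * g y)) summable_on A \<times> B"
proof (rule iffD2[OF Infinite_Sum.abs_summable_on_Sigma_iff], intro conjI ballI)
  fix x
  show "(\<lambda>y. norm (case (x, y) of (x, y) \<Rightarrow> f x * g y)) summable_on B"
    using summable_on_cmult_right[OF assms(2), of "norm (f x)"] by (simp add: norm_mult)
next
  have "(\<lambda>x. norm (f x) * (\<Sum>\<^sub>\<infinity>y\<in>B. norm (g y))) summable_on A"
    by (rule summable_on_cmult_left[OF assms(1)])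
  then show "(\<lambda>x. norm (\<Sum>\<^sub>\<infinity>y\<in>B. norm (case (x, y) of (x, y) \<Rightarrow> f x * g y))) summable_on A"
    by (simp add: norm_mult infsum_cmult_right' infsum_nonneg)
qed

lemma has_sum_times:
  fixes f :: "'a \<Rightarrow> 'c::{real_normed_field,banach}" and g :: "'b \<Rightarrow> 'c"
  assumes "(\<lambda>x. norm (f x)) summable_on A" "(\<lambda>y. norm (g y)) summable_on B"
  shows "((\<lambda>(x, y). f x * g y) has_sum infsum f A * infsum g B) (A \<times> B)"
proof -
  have s: "(\<lambda>(x, y). f x * g y) summable_on A \<times> B"
    by (rule Infinite_Sum.abs_summable_summable[OF norm_summable_on_times[OF assms]])
  have "infsum (\<lambda>(x, y). f x * g y) (A \<times> B) = infsum f A * infsum g B"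
    by (simp add: infsum_Sigma'_banach[OF s, symmetric] infsum_cmult_right' infsum_cmult_left')
  then show ?thesis using has_sum_infsum[OF s] by simp
qed

lemma jtheta_mult_has_sum:
  fixes z w q :: "'a::{real_normed_field,banach}"
  assumes "z \<noteq> 0" "w \<noteq> 0" "q \<noteq> 0" "norm q < 1" "r \<noteq> 0" "norm r < 1"
  shows "((\<lambda>(m, n). (z powi m * q powi tri m) * (w powi n * r powi tri n)) has_sum jtheta z q * jtheta w r) UNIV"
  using has_sum_times[OF jtheta_abs_summable[of z q] jtheta_abs_summable[of w r]] assms
  unfolding jtheta_def by simp

lemma tri_add: "tri (m + n) = tri m + tri n + m * n"
proof -
  have "2 * tri (m + n) = 2 * (tri m + tri n + m * n)"
    unfolding distrib_left two_tri by (simp add: algebra_simps)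
  then show ?thesis by (rule eq_if_double_eq)
qed

lemma tri_uminus: "tri (- n) = tri n + n"
proof -
  have "2 * tri (- n) = 2 * (tri n + n)"
    unfolding distrib_left two_tri by (simp add: algebra_simps)
  then show ?thesis by (rule eq_if_double_eq)
qed

lemma tri_1 [simp]: "tri 1 = 0" by (simp add: tri_def)

text \<open>Sorting the terms of the double series by the parity of \<open>m + n\<close> turns the product into
  a \<open>2 \<times> 2\<close> determinant, so that the three-term relation becomes a Pluecker relation.\<close>

lemma jtheta_mult_determinant:
  fixes x y q :: "'a::{real_normed_field,banach}"
  assumes [simp]: "x \<noteq> 0" "y \<noteq> 0" "q \<noteq> 0" and q: "norm q < 1"
  defines "A \<equiv> \<lambda>x. jtheta (x^2 * q) (q^2)" and "B \<equiv> \<lambda>x. x * jtheta (x^2 * q^2) (q^2)"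
  shows "jtheta (- (x * y)) q * jtheta (- (x / y)) q = x * (B x * A y - A x * B y)"
proof -
  have q2: "norm (q^2) < 1" using q by (simp add: norm_power power_less_one_iff)
  define F where "F = (\<lambda>(m, n). ((- (x * y)) powi m * q powi tri m) * ((- (x / y)) powi n * q powi tri n))"
  have F: "(F has_sum jtheta (- (x * y)) q * jtheta (- (x / y)) q) UNIV"
    unfolding F_def by (rule jtheta_mult_has_sum) (use q in auto)
  define T where "T = (\<lambda>r s (m, n). ((x^2 * q ^ r) powi m * (q^2) powi tri m) * ((y^2 * q ^ s) powi n * (q^2) powi tri n))"
  have TS: "(T r s has_sum jtheta (x^2 * q ^ r) (q^2) * jtheta (y^2 * q ^ s) (q^2)) UNIV" for r s
    unfolding T_def by (rule jtheta_mult_has_sum) (use q2 in auto)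
  have powi: "(u * v) powi j = u powi j * v powi j" for u v :: 'a and j
    by (rule power_int_mult_distrib)
  have pow_xy: "(- (x * y)) powi j = (- 1) powi j * x powi j * y powi j" for j
    using powi[of "- 1" "x * y" j] by (simp add: powi)
  have pow_xdivy: "(- (x / y)) powi j = (- 1) powi j * x powi j / y powi j" for j
    using powi[of "- 1" "x / y" j] by (simp add: power_int_divide_distrib)
  \<comment> \<open>The shift of \<open>j\<close> by 1 produces the argument
    \<open>x^2 * q^2\<close> instead of \<open>x^2\<close>, so that the even and the odd terms
    involve the same functions \<open>A\<close> and \<open>B\<close>.\<close>
  have even: "F (j + 1 + l, j + 1 - l) = x^2 * T 2 1 (j, l)" for j l
  proof -
    have e: "tri (j + 1 + l) + tri (j + 1 - l) = 2 * j + 2 * tri j + l + 2 * tri l"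
      using tri_add[of "j + 1" l] tri_add[of "j + 1" "- l"] tri_add[of j 1] tri_uminus[of l] 
      by (simp add: algebra_simps)
    have "F (j + 1 + l, j + 1 - l)
       = ((- 1) powi (j + 1 + l) * (- 1) powi (j + 1 - l)) * (x powi (j + 1 + l) * x powi (j + 1 - l))
         * (y powi (j + 1 + l) / y powi (j + 1 - l)) * (q powi tri (j + 1 + l) * q powi tri (j + 1 - l))"
      unfolding F_def prod.case pow_xy pow_xdivy by (simp add: field_simps)
    also have "\<dots> = (- 1) powi (2 * (j + 1)) * x powi (2 + 2 * j) * y powi (2 * l) 
         * q powi (2 * j + 2 * tri j + l + 2 * tri l)"
      by (simp add: e flip: power_int_add power_int_diff) (simp add: algebra_simps)
    also have "\<dots> = x^2 * T 2 1 (j, l)"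
      unfolding T_def by (simp add: powi power_int_add power_int_mult)
    finally show ?thesis .
  qed
  have odd: "F (j + l + 1, j - l) = - (x * y) * T 1 2 (j, l)" for j l
  proof -
    have e: "tri (j + l + 1) + tri (j - l) = j + 2 * tri j + 2 * l + 2 * tri l"
      using tri_add[of "j + l" 1] tri_add[of j l] tri_add[of j "- l"] tri_uminus[of l] 
      by (simp add: algebra_simps)
    have "F (j + l + 1, j - l)
       = ((- 1) powi (j + l + 1) * (- 1) powi (j - l)) * (x powi (j + l + 1) * x powi (j - l))
         * (y powi (j + l + 1) / y powi (j - l)) * (q powi tri (j + l + 1) * q powi tri (j - l))"
      unfolding F_def prod.case pow_xy pow_xdivy by (simp add: field_simps)
    also have "\<dots> = (- 1) powi (2 * j + 1) * x powi (2 * j + 1) * y powi (2 * l + 1) 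
         * q powi (j + 2 * tri j + 2 * l + 2 * tri l)"
      by (simp add: e flip: power_int_add power_int_diff)
    also have "\<dots> = - (x * y) * T 1 2 (j, l)"
      unfolding T_def by (simp add: powi power_int_add power_int_mult)
    finally show ?thesis .
  qed
  have E: "(F has_sum x^2 * (jtheta (x^2 * q ^ 2) (q^2) * jtheta (y^2 * q ^ 1) (q^2))) {(m, n). even (m + n)}"
  proof -
    have "((\<lambda>p. x^2 * T 2 1 p) has_sum x^2 * (jtheta (x^2 * q ^ 2) (q^2) * jtheta (y^2 * q ^ 1) (q^2))) UNIV"
      by (rule has_sum_cmult_right[OF TS])
    moreover have "((\<lambda>p. x^2 * T 2 1 p) has_sum c) UNIV \<longleftrightarrow> (F has_sum c) {(m, n). even (m + n)}" for c
    proof (rule has_sum_reindex_bij_witness[where j = "\<lambda>(j, l). (j + 1 + l, j + 1 - l)" and i = "\<lambda>(m, n). ((m + n) div 2 - 1, (m - n) div 2)"])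
      fix p :: "int \<times> int" assume "p \<in> {(m, n). even (m + n)}"
      then show "(case case p of (m, n) \<Rightarrow> ((m + n) div 2 - 1, (m - n) div 2) of (j, l) \<Rightarrow> (j + 1 + l, j + 1 - l)) = p"
        by (cases p, clarsimp, presburger)
    qed (auto simp: even)
    ultimately show ?thesis by simp
  qed
  have O: "(F has_sum - (x * y) * (jtheta (x^2 * q ^ 1) (q^2) * jtheta (y^2 * q ^ 2) (q^2))) {(m, n). odd (m + n)}"
  proof -
    have "((\<lambda>p. - (x * y) * T 1 2 p) has_sum - (x * y) * (jtheta (x^2 * q ^ 1) (q^2) * jtheta (y^2 * q ^ 2) (q^2))) UNIV"
      by (rule has_sum_cmult_right[OF TS])
    moreover have "((\<lambda>p. - (x * y) * T 1 2 p) has_sum c) UNIV \<longleftrightarrow> (F has_sum c) {(m, n). odd (m + n)}" for c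
    proof (rule has_sum_reindex_bij_witness[where j = "\<lambda>(j, l). (j + l + 1, j - l)" and i = "\<lambda>(m, n). ((m + n - 1) div 2, (m - n - 1) div 2)"])
      fix p :: "int \<times> int" assume "p \<in> {(m, n). odd (m + n)}"
      then show "(case case p of (m, n) \<Rightarrow> ((m + n - 1) div 2, (m - n - 1) div 2) of (j, l) \<Rightarrow> (j + l + 1, j - l)) = p"
        by (cases p, clarsimp, presburger)
    qed (auto simp: odd)
    ultimately show ?thesis by simp
  qed
  have "UNIV = {(m :: int, n :: int). even (m + n)} \<union> {(m, n). odd (m + n)}" by auto
  then have "(F has_sum x^2 * (jtheta (x^2 * q ^ 2) (q^2) * jtheta (y^2 * q ^ 1) (q^2))
       + - (x * y) * (jtheta (x^2 * q ^ 1) (q^2) * jtheta (y^2 * q ^ 2) (q^2))) UNIV"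
    using has_sum_Un_disjoint[OF E O] by (auto simp: disjoint_iff)
  then show ?thesis
    using has_sum_unique[OF F] by (simp add: A_def B_def power2_eq_square algebra_simps)
qed

lemma jtheta_three_term:
  fixes x y u v q :: "'a::{real_normed_field,banach}"
  assumes "x \<noteq> 0" "y \<noteq> 0" "u \<noteq> 0" "v \<noteq> 0" "q \<noteq> 0" "norm q < 1"
  defines "\<theta> \<equiv> \<lambda>z. jtheta (- z) q"
  shows "\<theta> (x * y) * \<theta> (x / y) * (\<theta> (u * v) * \<theta> (u / v)) - \<theta> (x * v) * \<theta> (x / v) * (\<theta> (u * y) * \<theta> (u / y))
    = u / y * (\<theta> (y * v) * \<theta> (y / v) * (\<theta> (x * u) * \<theta> (x / u)))"
proof -
  define A where "A x = jtheta (x^2 * q) (q^2)" for x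
  define B where "B x = x * jtheta (x^2 * q^2) (q^2)" for x
  have D: "\<theta> (a * b) * \<theta> (a / b) = a * (B a * A b - A a * B b)" if "a \<noteq> 0" "b \<noteq> 0" for a b
    unfolding \<theta>_def A_def B_def by (rule jtheta_mult_determinant) (use that assms in auto)
  define P where "P = B y * A v - A y * B v"
  define Q where "Q = B x * A u - A x * B u"
  have "\<theta> (x * y) * \<theta> (x / y) * (\<theta> (u * v) * \<theta> (u / v)) - \<theta> (x * v) * \<theta> (x / v) * (\<theta> (u * y) * \<theta> (u / y))
    = u * (x * (P * Q))"
    unfolding D[OF assms(1,2)] D[OF assms(3,4)] D[OF assms(1,4)] D[OF assms(3,2)] P_def Q_def
    by (simp only: algebra_simps)
  also have "\<dots> = u / y * (y * P * (x * Q))" using assms(2) by simp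
  finally show ?thesis unfolding D[OF assms(2,4)] D[OF assms(1,3)] P_def Q_def .
qed

section \<open>A quintic identity\<close>

lemma roots_of_unity_5:
  defines "z \<equiv> cis (2 * pi / 5)"
  shows "z ^ 5 = 1" "1 + z + z^2 + z^3 + z^4 = 0"
proof -
  show 1: "z ^ 5 = 1" using Complex.DeMoivre[of "2 * pi / 5" 5] by (simp add: z_def)
  have "cos (2 * pi / 5) \<noteq> 1"
  proof
    assume "cos (2 * pi / 5) = 1"
    moreover have "cos (2 * pi / 5) < cos 0" by (rule cos_monotone_0_pi) auto
    ultimately show False by simp
  qed
  then have 2: "z \<noteq> 1" by (auto simp: z_def complex_eq_iff)
  have "(1 - z) * (1 + z + z^2 + z^3 + z^4) = 1 - z ^ 5" by (simp add: algebra_simps power_numeral_reduce)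
  then show "1 + z + z^2 + z^3 + z^4 = 0" using 1 2 by simp
qed

lemma prod_roots_of_unity_5:
  fixes z y :: "'a::idom"
  assumes "1 + z + z^2 + z^3 + z^4 = 0"
  shows "(\<Prod>i<5. 1 - z ^ i * y) = 1 - y ^ 5"
proof -
  have z4: "z ^ 4 = - (1 + z + z^2 + z^3)" using assms by (simp add: eq_neg_iff_add_eq_0 algebra_simps)
  have z5: "z ^ 5 = 1"
  proof -
    have "z ^ 5 - 1 = (z - 1) * (1 + z + z^2 + z^3 + z^4)"
      by (simp add: algebra_simps power_numeral_reduce)
    then show ?thesis using assms by simp
  qed
  \<comment> \<open>\<open>a\<close> and \<open>b\<close> are the Gaussian periods, with
    \<open>a + b = a * b = - 1\<close>; pairing inverse roots leaves two quadratic factors with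
    coefficients in them.\<close>
  define a where "a = z + z^4"
  define b where "b = z^2 + z^3"
  have b: "b = - 1 - a" unfolding a_def b_def z4 by simp
  have zk: "z ^ 6 = z" "z ^ 7 = z ^ 2"
    using z5 power_add[of z 5 1] power_add[of z 5 2] by simp_all
  have "a * b = z^3 + z^4 + z^6 + z^7" unfolding a_def b_def by (simp add: algebra_simps flip: power_Suc power_add)
  also have "\<dots> = - 1" unfolding zk z4 by simp
  finally have ab: "a * b = - 1" .
  have "(\<Prod>i<5. 1 - z ^ i * y) = (1 - y) * ((1 - z * y) * (1 - z^4 * y)) * ((1 - z^2 * y) * (1 - z^3 * y))"
    by (simp add: numeral_eq_Suc lessThan_Suc)
  also have "(1 - z * y) * (1 - z^4 * y) = 1 - a * y + z ^ 5 * y^2"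
    by (simp add: a_def algebra_simps power_numeral_reduce)
  also have "(1 - z^2 * y) * (1 - z^3 * y) = 1 - b * y + z ^ 5 * y^2"
    by (simp add: b_def algebra_simps power_numeral_reduce)
  also have "(1 - y) * (1 - a * y + z ^ 5 * y^2) * (1 - b * y + z ^ 5 * y^2)
    = (1 - y) * (1 - (a + b) * y + (2 + a * b) * y^2 - (a + b) * y^3 + y^4)"
    unfolding z5 by (simp add: algebra_simps power_numeral_reduce)
  also have "\<dots> = 1 - y ^ 5"
    unfolding ab unfolding b by (simp add: algebra_simps power_numeral_reduce)
  finally show ?thesis .
qed

text \<open>The product of theta series at \<open>z\<close> and \<open>z^2\<close> attaches
  \<open>z powi (m + 2 * n)\<close> to \<open>(m, n)\<close>. Since 2 is a square root of -1 modulo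
  5, class 0 is the ideal (1 + 2i) of the Gaussian integers. Up to a constant,
  \<open>tri m + tri n\<close> is half the squared distance from (1/2, 1/2), a centre that lies
  formally in class 4; hence the special role of that class.\<close>

definition tri_class :: "int \<Rightarrow> (int \<times> int) set" where
  "tri_class c = {(m, n). (m + 2 * n) mod 5 = c}"

definition tri_class_sum :: "'a::{real_normed_field,banach} \<Rightarrow> int \<Rightarrow> 'a" where
  "tri_class_sum q c = (\<Sum>\<^sub>\<infinity>(m, n)\<in>tri_class c. q powi (tri m + tri n))"

lemma summable_tri:
  fixes q :: "'a::{real_normed_field,banach}"
  assumes "q \<noteq> 0" "norm q < 1"
  shows "(\<lambda>(m, n). q powi (tri m + tri n)) summable_on A"
proof -
  have "(\<lambda>(m, n). q powi (tri m + tri n)) summable_on UNIV"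
    using has_sum_imp_summable[OF jtheta_mult_has_sum[of 1 1 q q]] assms
    by (simp add: power_int_add)
  then show ?thesis using summable_on_subset_banach by blast
qed

lemma jtheta_mult_classes:
  fixes z q :: "'a::{real_normed_field,banach}"
  assumes z: "z ^ 5 = 1" and q: "q \<noteq> 0" "norm q < 1"
  shows "jtheta z q * jtheta (z^2) q = (\<Sum>c\<in>{0..<5}. z powi c * tri_class_sum q c)"
proof -
  have [simp]: "z \<noteq> 0" using z by auto
  define F where "F = (\<lambda>(m, n). z powi (m + 2 * n) * q powi (tri m + tri n))"
  have "F = (\<lambda>(m, n). (z powi m * q powi tri m) * ((z^2) powi n * q powi tri n))"
    using q by (simp add: F_def power_int_add power_int_mult fun_eq_iff)
  then have F: "(F has_sum jtheta z q * jtheta (z^2) q) UNIV"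
    using jtheta_mult_has_sum[of z "z^2" q q] q by simp
  have Fc: "F (m, n) = z powi c * q powi (tri m + tri n)" if "(m + 2 * n) mod 5 = c" for c m n
  proof -
    have "z powi (m + 2 * n) = z powi (5 * ((m + 2 * n) div 5) + c)"
      using that mult_div_mod_eq[of 5 "m + 2 * n"] by simp
    also have "\<dots> = (z powi 5) powi ((m + 2 * n) div 5) * z powi c"
      by (subst power_int_add) (auto simp: power_int_mult)
    finally show ?thesis using z by (simp add: F_def)
  qed
  have part: "(F has_sum (\<Sum>c\<in>C. z powi c * tri_class_sum q c)) (\<Union>c\<in>C. tri_class c)" if "finite C" for C
    using that
  proof (induction C rule: finite_induct)
    case (insert c C)
    have "((\<lambda>(m, n). q powi (tri m + tri n)) has_sum tri_class_sum q c) (tri_class c)"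
      unfolding tri_class_sum_def by (rule has_sum_infsum[OF summable_tri[OF q]])
    then have "((\<lambda>p. z powi c * (\<lambda>(m, n). q powi (tri m + tri n)) p) has_sum z powi c * tri_class_sum q c) (tri_class c)"
      by (rule has_sum_cmult_right)
    then have "(F has_sum z powi c * tri_class_sum q c) (tri_class c)"
      by (rule has_sum_cong[THEN iffD1, rotated]) (auto simp: tri_class_def Fc)
    moreover have "tri_class c \<inter> (\<Union>c\<in>C. tri_class c) = {}"
      using insert.hyps by (auto simp: tri_class_def)
    ultimately show ?case
      using has_sum_Un_disjoint[OF _ insert.IH] insert.hyps by simp
  qed simp
  have "(\<Union>c\<in>{0..<5}. tri_class c) = UNIV" by (auto simp: tri_class_def)
  then show ?thesis using part[of "{0..<5}"] has_sum_unique[OF F] by simp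
qed

text \<open>The rotation \<open>(m, n) \<mapsto> (n, 1 - m)\<close> preserves \<open>tri m + tri n\<close> and permutes four of the five classes cyclically.\<close>

lemma tri_class_sum_rotate:
  "tri_class_sum q ((3 * c + 2) mod 5) = tri_class_sum q c" if "c \<in> {0..<5}"
proof -
  have tri: "tri (1 - m) = tri m" for m
    using tri_add[of 1 "- m"] tri_uminus[of m] by simp
  show ?thesis
    unfolding tri_class_sum_def
  proof (rule infsum_reindex_bij_witness[where j = "\<lambda>(m, n). (1 - n, m)" and i = "\<lambda>(m, n). (n, 1 - m)"])
    fix p :: "int \<times> int"
    obtain m n where p: "p = (m, n)" by force
    show "(case p of (m, n) \<Rightarrow> (1 - n, m)) \<in> tri_class c" if "p \<in> tri_class ((3 * c + 2) mod 5)"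
    proof -
      have "(1 - n + 2 * m) mod 5 = (2 * (m + 2 * n) + 1) mod 5"
        using mod_mult_self1[of "2 * (m + 2 * n) + 1" "- n" 5] by (simp add: algebra_simps)
      also have "\<dots> = (2 * ((m + 2 * n) mod 5) + 1) mod 5" by (metis mod_add_left_eq mod_mult_right_eq)
      also have "(m + 2 * n) mod 5 = (3 * c + 2) mod 5" using that by (simp add: p tri_class_def)
      also have "(2 * ((3 * c + 2) mod 5) + 1) mod 5 = (2 * (3 * c + 2) + 1) mod 5"
        by (metis mod_add_left_eq mod_mult_right_eq)
      also have "2 * (3 * c + 2) + 1 = c + (c + 1) * 5" by simp
      also have "(c + (c + 1) * 5) mod 5 = c mod 5" by (rule mod_mult_self1)
      also have "c mod 5 = c" using \<open>c \<in> {0..<5}\<close> by simp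
      finally show ?thesis by (simp add: p tri_class_def)
    qed
    show "(case p of (m, n) \<Rightarrow> (n, 1 - m)) \<in> tri_class ((3 * c + 2) mod 5)" if "p \<in> tri_class c"
    proof -
      have "(n + 2 * (1 - m)) mod 5 = (3 * (m + 2 * n) + 2) mod 5"
        using mod_mult_self1[of "3 * (m + 2 * n) + 2" "- (m + n)" 5] by (simp add: algebra_simps)
      also have "\<dots> = (3 * ((m + 2 * n) mod 5) + 2) mod 5" by (metis mod_add_left_eq mod_mult_right_eq)
      also have "(m + 2 * n) mod 5 = c" using that by (simp add: p tri_class_def)
      finally show ?thesis by (simp add: p tri_class_def)
    qed
  qed (auto simp: tri add.commute)
qed

text \<open>The fixed class is the image of the whole lattice under a similarity of ratio \<open>sqrt 5\<close>.\<close>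

lemma tri_class_sum_4:
  fixes q :: "'a::{real_normed_field,banach}"
  assumes q: "q \<noteq> 0" "norm q < 1"
  shows "tri_class_sum q 4 = q * (jtheta 1 (q ^ 5))^2"
proof -
  have powi: "q powi (5 * t + 1) = q * (q ^ 5) powi t" for t
    using q by (simp add: power_int_add power_int_mult)
  have q5: "norm (q ^ 5) < 1" using q by (simp add: norm_power power_less_one_iff)
  have "((\<lambda>(m, n). (q ^ 5) powi (tri m + tri n)) has_sum (jtheta 1 (q ^ 5))^2) UNIV"
    using jtheta_mult_has_sum[of 1 1 "q ^ 5" "q ^ 5"] q q5 by (simp add: power_int_add power2_eq_square)
  then have "((\<lambda>p. q * (\<lambda>(m, n). (q ^ 5) powi (tri m + tri n)) p) has_sum q * (jtheta 1 (q ^ 5))^2) UNIV"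
    by (rule has_sum_cmult_right)
  moreover have "((\<lambda>p. q * (\<lambda>(m, n). (q ^ 5) powi (tri m + tri n)) p) has_sum c) UNIV
     \<longleftrightarrow> ((\<lambda>(m, n). q powi (tri m + tri n)) has_sum c) (tri_class 4)" for c
  \<comment> \<open>This map is multiplication by 1 + 2i about the fixed point (1/2, 1/2). It
    multiplies squared distances by 5, and the additive constant in \<open>tri m + tri n\<close>
    accounts for the extra 1 in the exponent.\<close>
  proof (rule has_sum_reindex_bij_witness[where j = "\<lambda>(a, b). (a - 2 * b + 1, 2 * a + b - 1)"
      and i = "\<lambda>(m, n). ((m + 2 * n + 1) div 5, (n - 2 * m + 3) div 5)"])
    fix p :: "int \<times> int"
    obtain m n where p: "p = (m, n)" by force
    show "(case case p of (a, b) \<Rightarrow> (a - 2 * b + 1, 2 * a + b - 1) of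
        (m, n) \<Rightarrow> ((m + 2 * n + 1) div 5, (n - 2 * m + 3) div 5)) = p"
      unfolding p by simp
    show "(case p of (a, b) \<Rightarrow> (a - 2 * b + 1, 2 * a + b - 1)) \<in> tri_class 4"
      unfolding p tri_class_def by clarsimp presburger
    show "(case case p of (m, n) \<Rightarrow> ((m + 2 * n + 1) div 5, (n - 2 * m + 3) div 5) of
       (a, b) \<Rightarrow> (a - 2 * b + 1, 2 * a + b - 1)) = p" if "p \<in> tri_class 4"
    proof -
      define k where "k = (m + 2 * n) div 5"
      have m: "m = 5 * k + 4 - 2 * n"
        using that mult_div_mod_eq[of 5 "m + 2 * n"] by (simp add: p tri_class_def k_def)
      have "m + 2 * n + 1 = (k + 1) * 5" "n - 2 * m + 3 = (n - 2 * k - 1) * 5"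
        unfolding m by simp_all
      then have "(m + 2 * n + 1) div 5 = k + 1" "(n - 2 * m + 3) div 5 = n - 2 * k - 1"
        by (simp_all only: nonzero_mult_div_cancel_right[of "5::int"] zero_neq_numeral[symmetric] not_False_eq_True simp_thms)
      then show ?thesis by (simp add: p m)
    qed
    have "2 * (tri (m - 2 * n + 1) + tri (2 * m + n - 1)) = 2 * (5 * (tri m + tri n) + 1)"
      unfolding distrib_left mult.left_commute[of 2 5] two_tri by (simp add: algebra_simps)
    then have "tri (m - 2 * n + 1) + tri (2 * m + n - 1) = 5 * (tri m + tri n) + 1"
      by (rule eq_if_double_eq)
    then show "(case case p of (a, b) \<Rightarrow> (a - 2 * b + 1, 2 * a + b - 1) of (m, n) \<Rightarrow> q powi (tri m + tri n))
      = q * (case p of (m, n) \<Rightarrow> (q ^ 5) powi (tri m + tri n))"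
      unfolding p by (simp only: prod.case powi)
  qed auto
  ultimately show ?thesis
    unfolding tri_class_sum_def by (simp add: infsumI)
qed

lemma qpoch_minus:
  fixes q z :: "'a::{real_normed_field,banach}"
  assumes "norm q < 1"
  shows "qpoch z q * qpoch (- z) q = qpoch (z ^ 2) (q ^ 2)"
  using qpoch_roots_of_unity[OF assms, where k = 2 and I = "{1, - 1}" and w = "\<lambda>x. x" and z = z]
  by (simp add: algebra_simps power2_eq_square)

lemma jtheta_1:
  fixes q :: "'a::{real_normed_field,banach}"
  assumes q: "q \<noteq> 0" "norm q < 1"
  shows "jtheta 1 q = 2 * (qpoch (q ^ 2) (q ^ 2))^2 / qpoch q q"
proof -
  have nz: "qpoch q q \<noteq> 0" by (rule qpoch_nonzero) (use q in auto)
  have "qpoch (- q) q = qpoch (q ^ 2) (q ^ 2) / qpoch q q"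
    using qpoch_minus[OF q(2), of q] nz by (simp add: field_simps)
  moreover have "jtheta 1 q = 2 * qpoch (- q) q ^ 2 * qpoch q q"
    using jacobi_triple_product[of 1 q] qpoch_unfold[OF q(2), of "- 1"] q by (simp add: power2_eq_square)
  ultimately show ?thesis using nz by (simp add: power2_eq_square)
qed

text \<open>The right-hand side is \<open>\<psi>(q)\<^sup>2 - 5 q \<psi>(q\<^sup>5)\<^sup>2\<close> for Ramanujan's \<open>\<psi>\<close>. For a fifth root of unity \<open>z\<close>,
  \<open>jtheta z q * jtheta (z\<^sup>2) q\<close> is the left-hand side up to a unit as a product, and a combination of
  the class sums as a series; \<open>jtheta 1 q\<close> supplies the other relation between the class sums.\<close>

lemma psi_quintic_identity_complex:
  fixes q :: complex
  assumes q: "q \<noteq> 0" "norm q < 1"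
  defines "f \<equiv> \<lambda>d. qpoch (q ^ d) (q ^ d)"
  shows "f 1 ^ 3 * f 10 / (f 2 * f 5) = (f 2 ^ 2 / f 1) ^ 2 - 5 * q * (f 10 ^ 2 / f 5) ^ 2"
proof -
  define z where "z = cis (2 * pi / 5)"
  have z5: "z ^ 5 = 1" and z0: "1 + z + z^2 + z^3 + z^4 = 0"
    using roots_of_unity_5 unfolding z_def by blast+
  have [simp]: "z \<noteq> 0" using z5 by auto
  have nq: "norm (q ^ d) < 1" if "d > 0" for d
    using q that by (simp add: norm_power power_less_one_iff)
  have nz: "f d \<noteq> 0" if "d > 0" for d
    unfolding f_def by (rule qpoch_nonzero) (use nq[OF that] in auto)
  have inv: "1 / z = z ^ 4" "1 / z ^ 2 = z ^ 3"
    using z5 by (simp_all add: field_simps power_numeral_reduce)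
  \<comment> \<open>Over all five roots the product collapses to base \<open>q ^ 5\<close>;
    splitting off the root 1 leaves the four factors that occur in the two theta values.\<close>
  have "(\<Prod>i<5. qpoch (z ^ i * (- q)) q) = qpoch ((- q) ^ 5) (q ^ 5)"
    by (rule qpoch_roots_of_unity) (use q prod_roots_of_unity_5[OF z0] in auto)
  then have "qpoch (- q) q * (qpoch (- (z * q)) q * qpoch (- (z^2 * q)) q * qpoch (- (z^3 * q)) q * qpoch (- (z^4 * q)) q)
      = qpoch (- (q ^ 5)) (q ^ 5)"
    by (simp add: numeral_eq_Suc lessThan_Suc mult_ac)
  moreover have "f 1 * qpoch (- q) q = f 2" "qpoch (- (q ^ 5)) (q ^ 5) = f 10 / f 5"
    using qpoch_minus[OF q(2), of q] qpoch_minus[OF nq, of 5 "q ^ 5"] nz[of 5]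
    by (simp_all add: f_def field_simps flip: power_mult)
  ultimately have P: "f 2 * (qpoch (- (z * q)) q * qpoch (- (z^2 * q)) q * qpoch (- (z^3 * q)) q * qpoch (- (z^4 * q)) q)
      = f 1 * f 10 / f 5"
    by (metis mult.assoc times_divide_eq_right)
  have "jtheta z q = (1 + z) * qpoch (- (z * q)) q * qpoch (- (z^4 * q)) q * f 1"
    using jacobi_triple_product[of z q] qpoch_unfold[OF q(2), of "- z"] q inv
    by (simp add: f_def divide_inverse mult_ac)
  moreover have "jtheta (z^2) q = (1 + z^2) * qpoch (- (z^2 * q)) q * qpoch (- (z^3 * q)) q * f 1"
    using jacobi_triple_product[of "z^2" q] qpoch_unfold[OF q(2), of "- (z^2)"] q inv
    by (simp add: f_def divide_inverse mult_ac)
  ultimately have "f 2 * (jtheta z q * jtheta (z^2) q)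
     = (1 + z) * (1 + z^2) * f 1 ^ 2 * (f 2 * (qpoch (- (z * q)) q * qpoch (- (z^2 * q)) q * qpoch (- (z^3 * q)) q * qpoch (- (z^4 * q)) q))"
    by (simp only: power2_eq_square mult_ac)
  also note P
  also have "(1 + z) * (1 + z^2) = - (z ^ 4)"
  proof -
    have "(1 + z) * (1 + z^2) = 1 + z + z^2 + z^3" by (simp add: algebra_simps power_numeral_reduce)
    then show ?thesis using z0 by (simp add: eq_neg_iff_add_eq_0)
  qed
  also have "- (z ^ 4) * f 1 ^ 2 * (f 1 * f 10 / f 5) = f 2 * (- (z ^ 4) * (f 1 ^ 3 * f 10 / (f 2 * f 5)))"
    using nz[of 2] by (simp add: power2_eq_square power3_eq_cube mult_ac)
  finally have lhs: "jtheta z q * jtheta (z^2) q = - (z ^ 4) * (f 1 ^ 3 * f 10 / (f 2 * f 5))"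
    using nz[of 2] by (metis mult_left_cancel zero_less_numeral)
  \<comment> \<open>The root \<open>z\<close> will yield \<open>S 0 - S 4\<close> and the root 1
    will yield \<open>4 * S 0 + S 4\<close>. Eliminating \<open>S 0\<close> leaves
    \<open>5 / 4 * S 4\<close>, and \<open>S 4\<close> has a factor 4; hence the coefficient
    5.\<close>
  define S where "S = tri_class_sum q"
  have Srot: "S 2 = S 0" "S 3 = S 0" "S 1 = S 0"
    using tri_class_sum_rotate[of 0 q] tri_class_sum_rotate[of 2 q] tri_class_sum_rotate[of 3 q] by (simp_all add: S_def)
  have set5: "{0..<5} = {0, 1, 2, 3, 4 :: int}" by auto
  have "jtheta z q * jtheta (z^2) q = S 0 * (1 + z + z^2 + z^3) + z^4 * S 4"
    unfolding jtheta_mult_classes[OF z5 q] set5 S_def[symmetric] by (simp add: Srot algebra_simps)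
  also have "1 + z + z^2 + z^3 = - (z ^ 4)" using z0 by (simp add: eq_neg_iff_add_eq_0)
  finally have "z ^ 4 * (f 1 ^ 3 * f 10 / (f 2 * f 5)) = z ^ 4 * (S 0 - S 4)"
    unfolding lhs by (simp add: algebra_simps)
  then have 1: "f 1 ^ 3 * f 10 / (f 2 * f 5) = S 0 - S 4"
    by (simp only: mult_cancel_left power_eq_0_iff \<open>z \<noteq> 0\<close> simp_thms)
  have sq: "(2 * y)^2 = 4 * y^2" for y :: complex by (simp add: power_mult_distrib)
  have "(jtheta 1 q)^2 = 4 * S 0 + S 4"
    using jtheta_mult_classes[OF _ q, of 1] unfolding set5 S_def[symmetric] by (simp add: Srot power2_eq_square)
  moreover have "jtheta 1 q = 2 * (f 2 ^ 2 / f 1)" using jtheta_1[OF q] by (simp add: f_def)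
  ultimately have "4 * S 0 + S 4 = 4 * (f 2 ^ 2 / f 1) ^ 2" by (metis sq)
  then have 2: "4 * S 0 = 4 * (f 2 ^ 2 / f 1) ^ 2 - S 4" by (simp only: eq_diff_eq)
  have "jtheta 1 (q ^ 5) = 2 * (f 10 ^ 2 / f 5)"
    using jtheta_1[of "q ^ 5"] nq[of 5] q by (simp add: f_def flip: power_mult)
  then have "S 4 = q * (2 * (f 10 ^ 2 / f 5)) ^ 2"
    using tri_class_sum_4[OF q] by (simp add: S_def)
  then have 4: "S 4 = 4 * (q * (f 10 ^ 2 / f 5) ^ 2)" by (simp only: sq mult.left_commute)
  have "4 * (S 0 - S 4) = 4 * ((f 2 ^ 2 / f 1) ^ 2 - 5 * q * (f 10 ^ 2 / f 5) ^ 2)"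
    unfolding right_diff_distrib 2 unfolding 4 by (simp add: algebra_simps)
  then show ?thesis unfolding 1 by (simp only: mult_cancel_left) simp
qed

lemma psi_quintic_identity:
  fixes q :: real
  assumes q: "0 < q" "q < 1"
  defines "f \<equiv> \<lambda>d. qpoch (q ^ d) (q ^ d)"
  shows "f 1 ^ 3 * f 10 / (f 2 * f 5) = (f 2 ^ 2 / f 1) ^ 2 - 5 * q * (f 10 ^ 2 / f 5) ^ 2"
proof -
  have f: "qpoch (complex_of_real q ^ d) (complex_of_real q ^ d) = complex_of_real (f d)" if "d > 0" for d
    unfolding f_def using q that qpoch_of_real[of "q ^ d" "q ^ d", where 'a = complex]
    by (simp add: norm_power power_less_one_iff)
  have *: "norm (complex_of_real q) < 1" "complex_of_real q \<noteq> 0" using q by auto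
  have "complex_of_real (f 1 ^ 3 * f 10 / (f 2 * f 5))
     = complex_of_real ((f 2 ^ 2 / f 1) ^ 2 - 5 * q * (f 10 ^ 2 / f 5) ^ 2)"
    using psi_quintic_identity_complex[OF *(2,1)] f[of 1] f[of 2] f[of 5] f[of 10] by simp
  then show ?thesis by (simp only: of_real_eq_iff)
qed

section \<open>The continued fraction as a quotient of theta functions\<close>

text \<open>Pairing the index \<open>r\<close> with \<open>- (r + 1)\<close> gives the one-sided
  form in which Rogers' series appear.\<close>

lemma jtheta_sums:
  fixes z q :: "'a::{real_normed_field,banach}"
  assumes "z \<noteq> 0" "q \<noteq> 0" "norm q < 1"
  shows "(\<lambda>r. z ^ r * q ^ (r choose 2) + (q / z) ^ Suc r * q ^ (Suc r choose 2)) sums jtheta z q"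
proof -
  define F where "F n = z powi n * q powi tri n" for n
  have "F summable_on UNIV"
    unfolding F_def by (rule Infinite_Sum.abs_summable_summable[OF jtheta_abs_summable[OF assms]])
  then have F: "F summable_on A" for A by (rule summable_on_subset_banach) simp
  have e: "F (int r) = z ^ r * q ^ (r choose 2)" for r
    by (simp add: F_def tri_int power_int_of_nat)
  have e': "F (- int (Suc r)) = (q / z) ^ Suc r * q ^ (Suc r choose 2)" for r
    unfolding F_def tri_uminus tri_int using assms
    by (simp add: power_int_minus power_int_of_nat power_int_add power_divide field_simps del: of_nat_Suc power_Suc)
  have disj: "range int \<inter> range (\<lambda>r. - int (Suc r)) = {}" by auto
  have un: "UNIV = range int \<union> range (\<lambda>r. - int (Suc r))"
  proof -
    have "x \<in> range int \<union> range (\<lambda>n. - int (Suc n))" for x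
      by (cases x rule: int_cases) (auto simp: image_iff)
    then show ?thesis by blast
  qed
  have "((\<lambda>r. F (int r)) has_sum infsum F (range int)) UNIV"
    using has_sum_reindex[of int UNIV F "infsum F (range int)"] has_sum_infsum[OF F, of "range int"]
    by (simp add: o_def)
  then have 1: "(\<lambda>r. F (int r)) sums infsum F (range int)" by (rule has_sum_imp_sums)
  have "((\<lambda>r. F (- int (Suc r))) has_sum infsum F (range (\<lambda>r. - int (Suc r)))) UNIV"
    using has_sum_reindex[of "\<lambda>r. - int (Suc r)" UNIV F "infsum F (range (\<lambda>r. - int (Suc r)))"]
      has_sum_infsum[OF F, of "range (\<lambda>r. - int (Suc r))"]
    by (simp add: o_def inj_on_def del: of_nat_Suc)
  then have 2: "(\<lambda>r. F (- int (Suc r))) sums infsum F (range (\<lambda>r. - int (Suc r)))" by (rule has_sum_imp_sums)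
  have "jtheta z q = infsum F (range int) + infsum F (range (\<lambda>r. - int (Suc r)))"
    unfolding jtheta_def F_def[symmetric] by (subst un, rule infsum_Un_disjoint[OF F F disj])
  then show ?thesis using sums_add[OF 1 2] unfolding e e' by simp
qed

lemma qpoch_split:
  fixes z q :: "'a::{real_normed_field,banach}"
  assumes "norm q < 1"
  shows "qpoch z q = (\<Prod>i<r. 1 - z * q ^ i) * qpoch (z * q ^ r) q"
proof (induction r)
  case (Suc r)
  then show ?case using qpoch_unfold[OF assms, of "z * q ^ r"] by (simp add: mult_ac)
qed simp

lemma qpoch_real_bounds:
  fixes z q :: real
  assumes "0 < q" "q < 1" "0 \<le> z" "z < 1"
  shows "0 < qpoch z q" "qpoch z q \<le> 1 - z"
proof -
  have nq: "norm q < 1" using assms by simp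
  have le: "0 \<le> 1 - z * q ^ i" "1 - z * q ^ i \<le> 1" for i
    using assms mult_mono[of z 1 "q ^ i" 1] by (auto simp: power_le_one)
  have "0 \<le> qpoch z q"
    by (rule LIMSEQ_le_const[OF qpoch_LIMSEQ[OF nq]]) (auto intro: prod_nonneg le)
  moreover have "qpoch z q \<noteq> 0" by (rule qpoch_nonzero) (use assms in auto)
  ultimately show "0 < qpoch z q" by simp
  have "qpoch (z * q) q \<le> 1"
    by (rule LIMSEQ_le_const2[OF qpoch_LIMSEQ[OF nq]])
      (use le[of "Suc _"] in \<open>auto intro!: prod_le_1 simp: mult.assoc\<close>)
  then have "(1 - z) * qpoch (z * q) q \<le> (1 - z) * 1" using assms by (intro mult_left_mono) auto
  then show "qpoch z q \<le> 1 - z" using qpoch_unfold[OF nq, of z] by simp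
qed

section \<open>Rogers' series and the convergence of the continued fraction\<close>

locale rogers_series =
  fixes x :: real
  assumes x: "0 < x" "x < 1"
begin

text \<open>The functions \<open>H\<^sub>1\<close> and \<open>H\<^sub>2\<close> of Rogers, as in Hardy and Wright, section 19.14, where the weight is
  written \<open>P\<^sub>r Q\<^sub>r\<close>.\<close>

definition weight :: "real \<Rightarrow> nat \<Rightarrow> real" where
  "weight a r = 1 / ((\<Prod>i<r. 1 - x * x ^ i) * qpoch (a * x ^ r) x)"

definition H1_term :: "real \<Rightarrow> nat \<Rightarrow> real" where
  "H1_term a r = (-1) ^ r * a ^ (2 * r) * x ^ (5 * (r choose 2) + 2 * r) * (1 - a * x ^ (2 * r)) * weight a r"

definition H2_term :: "real \<Rightarrow> nat \<Rightarrow> real" where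
  "H2_term a r = (-1) ^ r * a ^ (2 * r) * x ^ (5 * (r choose 2) + r) * (1 - a^2 * x ^ (4 * r)) * weight a r"

definition H1 :: "real \<Rightarrow> real" where "H1 a = suminf (H1_term a)"
definition H2 :: "real \<Rightarrow> real" where "H2 a = suminf (H2_term a)"

lemma nx: "norm x < 1" using x by simp

lemma qpoch_shift_ge:
  assumes "0 < a" "a < 1"
  shows "qpoch a x \<le> qpoch (a * x ^ r) x" "0 < qpoch (a * x ^ r) x"
proof -
  have "a * x ^ r \<le> a" using assms x by (intro mult_right_le_one_le power_le_one) auto
  then have ar: "0 \<le> a * x ^ r" "a * x ^ r < 1" using assms x le_less_trans[of "a * x ^ r" a 1] by simp_all
  then show p: "0 < qpoch (a * x ^ r) x" using x by (intro qpoch_real_bounds) auto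
  have le: "0 \<le> 1 - a * x ^ i" "1 - a * x ^ i \<le> 1" for i
    using assms x mult_mono[of a 1 "x ^ i" 1] by (auto simp: power_le_one)
  have "(\<Prod>i<r. 1 - a * x ^ i) * qpoch (a * x ^ r) x \<le> 1 * qpoch (a * x ^ r) x"
    using p by (intro mult_right_mono prod_le_1 conjI le) simp
  then show "qpoch a x \<le> qpoch (a * x ^ r) x" using qpoch_split[OF nx, of a r] by simp
qed

lemma weight_bounds:
  assumes "0 < a" "a < 1"
  shows "0 < weight a r" "weight a r \<le> 1 / (qpoch x x * qpoch a x)"
proof -
  have split: "qpoch x x = (\<Prod>i<r. 1 - x * x ^ i) * qpoch (x * x ^ r) x"
    by (rule qpoch_split[OF nx])
  have qx: "0 < qpoch x x" "0 < qpoch (x * x ^ r) x" "0 < qpoch a x"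
    using qpoch_shift_ge[of x] qpoch_real_bounds[of x] x assms by auto
  have "x * x ^ r < 1" using x power_less_one_iff[of x "Suc r"] by simp
  then have "qpoch (x * x ^ r) x \<le> 1" using qpoch_real_bounds(2)[of x "x * x ^ r"] x
    by (smt (verit) mult_nonneg_nonneg zero_le_power)
  moreover have pp: "0 < (\<Prod>i<r. 1 - x * x ^ i)" using split qx by (metis zero_less_mult_pos2)
  ultimately have "qpoch x x \<le> (\<Prod>i<r. 1 - x * x ^ i)" using split
    by (metis mult.right_neutral mult_left_mono less_imp_le)
  then have "qpoch x x * qpoch a x \<le> (\<Prod>i<r. 1 - x * x ^ i) * qpoch (a * x ^ r) x"
    using qpoch_shift_ge[OF assms] qx pp by (intro mult_mono) auto
  then show "weight a r \<le> 1 / (qpoch x x * qpoch a x)"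
    unfolding weight_def using qx by (intro divide_left_mono mult_pos_pos) (auto intro: pp qpoch_shift_ge assms)
  show "0 < weight a r" unfolding weight_def using pp qpoch_shift_ge[OF assms] by simp
qed

text \<open>The weights are bounded in \<open>r\<close>, so a geometric series in \<open>a^2\<close>
  dominates. The second estimate makes everything after the first term small as \<open>a\<close>
  tends to 0, which later settles a sign.\<close>

lemma summable_weight:
  assumes a: "0 < a" "a < 1" and c: "\<And>r. \<bar>c r\<bar> \<le> 1"
  shows "summable (\<lambda>r. a ^ (2 * r) * c r * weight a r)"
    "\<bar>\<Sum>r. a ^ (2 * Suc r) * c (Suc r) * weight a (Suc r)\<bar> \<le> a^2 / (1 - a^2) / (qpoch x x * qpoch a x)"
proof -
  let ?D = "1 / (qpoch x x * qpoch a x)"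
  have a2: "a^2 < 1" "0 < a^2" using a by (auto simp: power_less_one_iff)
  have bound: "norm (a ^ (2 * r) * c r * weight a r) \<le> (a^2) ^ r * ?D" for r
  proof -
    have "norm (a ^ (2 * r) * c r * weight a r) = (a^2) ^ r * (\<bar>c r\<bar> * weight a r)"
      using a weight_bounds(1)[OF a, of r] by (simp add: abs_mult power_mult)
    also have "\<dots> \<le> (a^2) ^ r * (1 * ?D)"
      using a c[of r] weight_bounds[OF a, of r] by (intro mult_left_mono mult_mono) auto
    finally show ?thesis by simp
  qed
  have gs: "(\<lambda>r. (a^2) ^ r * ?D) sums (1 / (1 - a^2) * ?D)"
    by (intro sums_mult2 geometric_sums) (use a2 in auto)
  show "summable (\<lambda>r. a ^ (2 * r) * c r * weight a r)"
    by (rule summable_comparison_test'[OF sums_summable[OF gs], of 0]) (rule bound)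
  have gs': "(\<lambda>r. (a^2) ^ Suc r * ?D) sums (a^2 * (1 / (1 - a^2) * ?D))"
    using sums_mult[OF gs, of "a^2"] by (simp add: mult_ac)
  have "\<bar>\<Sum>r. a ^ (2 * Suc r) * c (Suc r) * weight a (Suc r)\<bar> \<le> (\<Sum>r. (a^2) ^ Suc r * ?D)"
    unfolding real_norm_def[symmetric] by (rule norm_suminf_le[OF bound sums_summable[OF gs']])
  also have "\<dots> = a^2 / (1 - a^2) / (qpoch x x * qpoch a x)"
    using sums_unique[OF gs'] by simp
  finally show "\<bar>\<Sum>r. a ^ (2 * Suc r) * c (Suc r) * weight a (Suc r)\<bar> \<le> a^2 / (1 - a^2) / (qpoch x x * qpoch a x)" .
qed

lemma coeff_le:
  assumes "0 \<le> b" "b \<le> 1"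
  shows "\<bar>(-1) ^ r * x ^ k * (1 - b)\<bar> \<le> 1"
  using assms x by (auto simp: abs_mult power_abs power_le_one intro!: mult_le_one)

lemma
  assumes a: "0 < a" "a < 1"
  shows summable_H1: "summable (H1_term a)" and summable_H2: "summable (H2_term a)"
proof -
  have "0 \<le> a * x ^ (2 * r)" "a * x ^ (2 * r) \<le> 1" "0 \<le> a^2 * x ^ (4 * r)" "a^2 * x ^ (4 * r) \<le> 1" for r
    using a x by (auto intro!: mult_le_one simp: power_le_one)
  then have "summable (\<lambda>r. a ^ (2 * r) * ((-1) ^ r * x ^ (5 * (r choose 2) + 2 * r) * (1 - a * x ^ (2 * r))) * weight a r)"
     "summable (\<lambda>r. a ^ (2 * r) * ((-1) ^ r * x ^ (5 * (r choose 2) + r) * (1 - a^2 * x ^ (4 * r))) * weight a r)"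
    by (auto intro!: summable_weight(1) a coeff_le)
  then show "summable (H1_term a)" "summable (H2_term a)"
    unfolding H1_term_def H2_term_def by (simp_all add: mult_ac)
qed

lemma weight_Suc:
  assumes "0 < a" "a < 1"
  shows "(1 - a * x ^ r) * weight a r = weight (a * x) r"
    "(1 - x ^ Suc r) * weight a (Suc r) = weight (a * x) r"
proof -
  have ar: "1 - a * x ^ r \<noteq> 0"
    using assms x mult_strict_mono'[of a 1 "x ^ r" "1"] by (metis diff_eq_diff_eq diff_zero less_irrefl linorder_not_less mult.right_neutral mult_left_le power_le_one less_imp_le order_le_less_trans eq_iff_diff_eq_0)
  have "1 - x ^ Suc r \<noteq> 0" using x power_less_one_iff[of x "Suc r"] by (simp del: power_Suc)
  then show "(1 - x ^ Suc r) * weight a (Suc r) = weight (a * x) r"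
    unfolding weight_def by (simp add: mult_ac)
  show "(1 - a * x ^ r) * weight a r = weight (a * x) r"
    unfolding weight_def using qpoch_unfold[OF nx, of "a * x ^ r"] ar by (simp add: mult_ac)
qed

text \<open>Both contiguity relations come from splitting the difference of the numerators into multiples
  of \<open>1 - a x\<^sup>r\<close> and \<open>1 - x\<^sup>r\<close> and shifting the index in the second part.\<close>

lemma H1_eq:
  assumes a: "0 < a" "a < 1"
  shows "H1 a = H2 (a * x)"
proof -
  \<comment> \<open>From \<open>1 - a * x ^ (2 * r) = x ^ r * (1 - a * x ^ r) + (1 - x ^ r)\<close>.
    As \<open>v 0 = 0\<close>, shifting the index in \<open>v\<close> loses no term.\<close>
  define u where "u r = (-1) ^ r * a ^ (2 * r) * x ^ (5 * (r choose 2) + 3 * r) * weight (a * x) r" for r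
  define v where "v r = (-1) ^ r * a ^ (2 * r) * x ^ (5 * (r choose 2) + 2 * r) * (1 - x ^ r) * weight a r" for r
  have sum: "H1_term a r = u r + v r" for r
    unfolding H1_term_def u_def v_def weight_Suc(1)[OF a, of r, symmetric]
    by (simp add: algebra_simps power_add power_mult power2_eq_square power3_eq_cube)
  have v0: "v 0 = 0" by (simp add: v_def)
  have H2: "H2_term (a * x) r = u r + v (Suc r)" for r
  proof -
    have "v (Suc r) = - ((-1) ^ r) * a ^ (2 * r + 2) * x ^ (5 * (r choose 2) + 7 * r + 2) * weight (a * x) r"
      unfolding v_def mult.assoc weight_Suc(2)[OF a]
      by (simp add: numeral_2_eq_2 algebra_simps power_add)
    then show ?thesis unfolding H2_term_def u_def
      by (simp add: algebra_simps power_add power_mult power_mult_distrib power2_eq_square power3_eq_cube power4_eq_xxxx power_numeral_reduce)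
  qed
  have "summable (\<lambda>r. a ^ (2 * r) * ((-1) ^ r * x ^ (5 * (r choose 2) + 2 * r) * (1 - x ^ r)) * weight a r)"
    by (rule summable_weight(1)[OF a coeff_le]) (use x in \<open>auto simp: power_le_one\<close>)
  then have v: "summable v" unfolding v_def by (simp add: mult_ac)
  then have u: "summable u" using summable_diff[OF summable_H1[OF a] v] sum by simp
  have "H1_term a = (\<lambda>r. u r + v r)" by (rule ext) (rule sum)
  then have "H1 a = suminf u + suminf v"
    unfolding H1_def using suminf_add[OF u v] by simp
  also have "suminf v = (\<Sum>r. v (Suc r))" using suminf_split_head[OF v] v0 by simp
  also have "suminf u + (\<Sum>r. v (Suc r)) = (\<Sum>r. H2_term (a * x) r)"
    unfolding H2 by (rule suminf_add[OF u summable_Suc_iff[THEN iffD2, OF v]])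
  also have "\<dots> = H2 (a * x)" by (simp add: H2_def)
  finally show ?thesis .
qed

lemma H2_eq:
  assumes a: "0 < a" "a < 1"
  shows "H2 a = H1 a + a * H1 (a * x)"
proof -
  \<comment> \<open>Here the difference of the numerators, common factors removed, is
    \<open>a * x ^ (4 * r) * (1 - a * x ^ r) + x ^ r * (1 - x ^ r)\<close>.\<close>
  define u where "u r = (-1) ^ r * a ^ (2 * r + 1) * x ^ (5 * (r choose 2) + 4 * r) * weight (a * x) r" for r
  define v where "v r = (-1) ^ r * a ^ (2 * r) * x ^ (5 * (r choose 2) + r) * (1 - x ^ r) * weight a r" for r
  have sum: "H2_term a r - H1_term a r = u r + v r" for r
    unfolding H1_term_def H2_term_def u_def v_def weight_Suc(1)[OF a, of r, symmetric]
    by (simp add: algebra_simps power_add power_mult power2_eq_square power4_eq_xxxx)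
  have v0: "v 0 = 0" by (simp add: v_def)
  have H1: "a * H1_term (a * x) r = u r + v (Suc r)" for r
  proof -
    have "v (Suc r) = - ((-1) ^ r) * a ^ (2 * r + 2) * x ^ (5 * (r choose 2) + 6 * r + 1) * weight (a * x) r"
      unfolding v_def mult.assoc weight_Suc(2)[OF a]
      by (simp add: numeral_2_eq_2 algebra_simps power_add)
    then show ?thesis unfolding H1_term_def u_def
      by (simp add: algebra_simps power_add power_mult power_mult_distrib power2_eq_square power3_eq_cube power4_eq_xxxx power_numeral_reduce)
  qed
  have "summable (\<lambda>r. a ^ (2 * r) * ((-1) ^ r * x ^ (5 * (r choose 2) + r) * (1 - x ^ r)) * weight a r)"
    by (rule summable_weight(1)[OF a coeff_le]) (use x in \<open>auto simp: power_le_one\<close>)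
  then have v: "summable v" unfolding v_def by (simp add: mult_ac)
  have ax: "0 < a * x" "a * x < 1" using a x mult_strict_mono[of a 1 x 1] by auto
  have "summable (\<lambda>r. a * H1_term (a * x) r - v (Suc r))"
    by (intro summable_diff summable_mult summable_H1 ax summable_Suc_iff[THEN iffD2, OF v])
  then have u: "summable u" by (simp add: H1)
  have "H2 a - H1 a = suminf u + suminf v"
    unfolding H1_def H2_def using suminf_diff[OF summable_H2[OF a] summable_H1[OF a]] suminf_add[OF u v]
    by (simp add: sum)
  also have "suminf v = (\<Sum>r. v (Suc r))" using suminf_split_head[OF v] v0 by simp
  also have "suminf u + (\<Sum>r. v (Suc r)) = (\<Sum>r. a * H1_term (a * x) r)"
    using suminf_add[OF u summable_Suc_iff[THEN iffD2, OF v]] by (simp add: H1)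
  also have "\<dots> = a * H1 (a * x)"
    unfolding H1_def by (rule suminf_mult[OF summable_H1[OF ax]])
  finally show ?thesis by simp
qed

text \<open>The contiguity relations reduce both families to this one sequence. Its three-term
  recurrence makes the ratios \<open>K n / K (Suc n)\<close> satisfy the recursion of the infinite
  continued fraction.\<close>

definition K :: "nat \<Rightarrow> real" where "K n = H2 (x ^ Suc n)"

lemma pow_x: "0 < x ^ Suc n" "x ^ Suc n < 1"
  using x power_less_one_iff[of x "Suc n"] by auto

lemma K_rec: "K n = K (Suc n) + x ^ Suc n * K (Suc (Suc n))"
proof -
  have "K n = H1 (x ^ Suc n) + x ^ Suc n * H1 (x ^ Suc n * x)"
    unfolding K_def by (rule H2_eq[OF pow_x])
  also have "x ^ Suc n * x = x ^ Suc (Suc n)" by simp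
  also have "H1 (x ^ Suc n) = K (Suc n)"
    unfolding K_def using H1_eq[OF pow_x, of n] by (simp add: mult_ac)
  also have "H1 (x ^ Suc (Suc n)) = K (Suc (Suc n))"
    unfolding K_def using H1_eq[OF pow_x, of "Suc n"] by (simp add: mult_ac)
  finally show ?thesis .
qed

lemma K_lower_bound:
  "K n \<ge> 1 - (x ^ Suc n)^2 - (x ^ Suc n)^2 / (1 - (x ^ Suc n)^2) / (qpoch x x * qpoch x x)"
proof -
  define a where "a = x ^ Suc n"
  have a: "0 < a" "a < 1" unfolding a_def by (rule pow_x)+
  have a2: "0 < a^2" "a^2 < 1" using a by (auto simp: power_less_one_iff)
  define c where "c r = (-1) ^ r * x ^ (5 * (r choose 2) + r) * (1 - a^2 * x ^ (4 * r))" for r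
  have "0 \<le> a^2 * x ^ (4 * r)" "a^2 * x ^ (4 * r) \<le> 1" for r
    using a x by (auto intro!: mult_le_one simp: power_le_one)
  then have c: "\<bar>c r\<bar> \<le> 1" for r unfolding c_def by (rule coeff_le)
  have H2c: "H2_term a r = a ^ (2 * r) * c r * weight a r" for r
    by (simp add: H2_term_def c_def mult_ac)
  have qa: "0 < qpoch a x" "qpoch a x \<le> 1" using qpoch_real_bounds[of x a] a x by auto
  have qx: "0 < qpoch x x" "qpoch x x \<le> qpoch a x"
    using qpoch_shift_ge(1)[of x n] qpoch_shift_ge(2)[of x 0] x by (auto simp: a_def)
  have c2: "(0::nat) choose 2 = 0" by simp
  have "1 - a^2 \<le> (1 - a^2) / qpoch a x"
    using a2 qa by (simp add: pos_le_divide_eq mult_left_le)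
  also have "\<dots> = H2_term a 0" by (simp add: H2_term_def weight_def c2)
  finally have t0: "1 - a^2 \<le> H2_term a 0" .
  have "\<bar>\<Sum>r. H2_term a (Suc r)\<bar> \<le> a^2 / (1 - a^2) / (qpoch x x * qpoch a x)"
    unfolding H2c by (rule summable_weight(2)[OF a c])
  also have "\<dots> \<le> a^2 / (1 - a^2) / (qpoch x x * qpoch x x)"
    using qx a2 by (intro divide_left_mono mult_left_mono mult_pos_pos divide_nonneg_nonneg) auto
  finally have t1: "\<bar>\<Sum>r. H2_term a (Suc r)\<bar> \<le> a^2 / (1 - a^2) / (qpoch x x * qpoch x x)" .
  have "K n = H2_term a 0 + (\<Sum>r. H2_term a (Suc r))"
    unfolding K_def H2_def a_def[symmetric] using suminf_split_head[OF summable_H2[OF a]] by simp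
  then show ?thesis using t0 t1 unfolding a_def[symmetric] by linarith
qed

text \<open>The series alternates, so its sign is not visible directly. The lower bound tends to 1,
  which settles large \<open>n\<close>; the recurrence has positive coefficients and carries
  positivity down.\<close>

lemma K_pos: "0 < K n"
proof -
  have "(\<lambda>n. x ^ Suc n) \<longlonglongrightarrow> 0" using x by (intro LIMSEQ_Suc LIMSEQ_realpow_zero) auto
  then have "(\<lambda>n. 1 - (x ^ Suc n)^2 - (x ^ Suc n)^2 / (1 - (x ^ Suc n)^2) / (qpoch x x * qpoch x x))
     \<longlonglongrightarrow> 1 - 0^2 - 0^2 / (1 - 0^2) / (qpoch x x * qpoch x x)"
    using qpoch_shift_ge(2)[of x 0] x by (intro tendsto_intros) auto
  then have "\<forall>\<^sub>F n in sequentially. 0 < 1 - (x ^ Suc n)^2 - (x ^ Suc n)^2 / (1 - (x ^ Suc n)^2) / (qpoch x x * qpoch x x)"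
    by (rule order_tendstoD) simp
  then obtain N where N: "\<And>m. m \<ge> N \<Longrightarrow> 0 < K m"
    unfolding eventually_sequentially using K_lower_bound by (meson less_le_trans)
  show ?thesis
  proof (induction "N - n" arbitrary: n rule: less_induct)
    case less
    show ?case
    proof (cases "n \<ge> N")
      case False
      then have "0 < K (Suc n)" "0 < K (Suc (Suc n))" by (auto intro!: less)
      then show ?thesis using pow_x[of n] by (subst K_rec) (auto intro!: add_pos_pos mult_pos_pos)
    qed (rule N)
  qed
qed

text \<open>The ratios obey the same recursion as \<open>rr_tail\<close>. All denominators are at
  least 1, so each level shrinks the error by a factor of at most \<open>x\<close>.\<close>

lemma rr_tail_error: "\<bar>rr_tail x 1 n - K 0 / K 1\<bar> \<le> x ^ n"
proof -
  define \<rho> where "\<rho> k = K k / K (Suc k)" for k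
  have rho: "\<rho> k = 1 + x ^ Suc k / \<rho> (Suc k)" for k
    unfolding \<rho>_def using K_pos[of "Suc k"] K_pos[of "Suc (Suc k)"] by (subst K_rec) (simp add: field_simps)
  have rho_pos: "\<rho> k > 0" for k unfolding \<rho>_def using K_pos by simp
  have rho1: "\<rho> k \<ge> 1" for k using rho[of k] rho_pos[of "Suc k"] x by (simp add: divide_nonneg_pos)
  have bound: "\<bar>rr_tail x (Suc k) n - \<rho> k\<bar> \<le> x ^ n" for k n
  proof (induction n arbitrary: k)
    case 0
    have "x ^ Suc k / \<rho> (Suc k) \<le> 1 / 1"
      using rho1 pow_x[of k] by (intro frac_le) auto
    moreover have "0 \<le> x ^ Suc k / \<rho> (Suc k)" using rho_pos[of "Suc k"] x by simp
    ultimately show ?case using rho[of k] by simp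
  next
    case (Suc n)
    define A where "A = rr_tail x (Suc (Suc k)) n"
    define B where "B = \<rho> (Suc k)"
    have AB: "A \<ge> 1" "B \<ge> 1" unfolding A_def B_def using rr_tail_ge_1[OF x(1)] rho1 by auto
    have AB1: "A * B \<ge> 1" using mult_mono[of 1 A 1 B] AB by simp
    have "rr_tail x (Suc k) (Suc n) - \<rho> k = x ^ Suc k * (B - A) / (A * B)"
      unfolding rho[of k] B_def[symmetric] rr_tail.simps(2) A_def[symmetric]
      using AB by (simp add: field_simps)
    then have "\<bar>rr_tail x (Suc k) (Suc n) - \<rho> k\<bar> = x ^ Suc k * \<bar>A - B\<bar> / (A * B)"
      using AB x by (simp add: abs_mult abs_minus_commute)
    also have "\<dots> \<le> x ^ Suc k * \<bar>A - B\<bar> / 1"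
      using AB1 x by (intro divide_left_mono) auto
    also have "\<dots> \<le> x ^ 1 * x ^ n"
      unfolding div_by_1 using x Suc.IH[of "Suc k"] unfolding A_def B_def by (intro mult_mono power_decreasing) auto
    finally show ?case by simp
  qed
  show ?thesis using bound[of 0 n] by (simp add: \<rho>_def)
qed

lemma rr_tail_LIMSEQ: "rr_tail x 1 \<longlonglongrightarrow> K 0 / K 1"
proof -
  have "(\<lambda>n. x ^ n) \<longlonglongrightarrow> 0" using x by (intro LIMSEQ_realpow_zero) auto
  then have "(\<lambda>n. rr_tail x 1 n - K 0 / K 1) \<longlonglongrightarrow> 0"
    by (rule Lim_null_comparison[rotated]) (use rr_tail_error in simp)
  then show ?thesis by (simp add: LIM_zero_iff)
qed

text \<open>At \<open>a = x\<close> the two parts of the weight join to the constant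
  \<open>1 / qpoch x x\<close>, and the series become theta series. \<open>K 1\<close> is reached at
  the same \<open>a\<close>, because it equals \<open>H1 x\<close>.\<close>

lemma K_theta:
  "K 0 = jtheta (- (x ^ 3)) (x ^ 5) / qpoch x x" "K 1 = jtheta (- (x ^ 4)) (x ^ 5) / qpoch x x"
proof -
  have w: "weight x r = 1 / qpoch x x" for r
    unfolding weight_def qpoch_split[OF nx, of x r] ..
  have ch: "Suc r choose 2 = (r choose 2) + r" for r by (simp add: numeral_2_eq_2)
  have x5: "norm (x ^ 5) < 1" using x by (simp add: power_less_one_iff)
  have div: "x ^ 5 / - (x ^ 3) = - (x ^ 2)" "x ^ 5 / - (x ^ 4) = - x"
    using x by (simp_all add: field_simps power_numeral_reduce)
  have pw: "(x ^ k) ^ r = (x ^ r) ^ k" for k r by (simp add: mult.commute flip: power_mult)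
  have "(- (x ^ 3)) ^ r * (x ^ 5) ^ (r choose 2) + (- (x ^ 2)) ^ Suc r * (x ^ 5) ^ (Suc r choose 2)
      = H2_term x r * qpoch x x" for r
    unfolding H2_term_def w ch power_minus[of "_ ^ _"] using qpoch_shift_ge(2)[of x 0] x
    by (simp add: algebra_simps power_add power_mult pw[of _ r] power_numeral_reduce)
  then have "(\<lambda>r. H2_term x r * qpoch x x) sums jtheta (- (x ^ 3)) (x ^ 5)"
    using jtheta_sums[of "- (x ^ 3)" "x ^ 5"] x x5 unfolding div by simp
  then have "(\<lambda>r. H2_term x r * qpoch x x / qpoch x x) sums (jtheta (- (x ^ 3)) (x ^ 5) / qpoch x x)"
    by (rule sums_divide)
  then show "K 0 = jtheta (- (x ^ 3)) (x ^ 5) / qpoch x x"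
    unfolding K_def H2_def using qpoch_shift_ge(2)[of x 0] x by (simp add: sums_iff)
  have "(- (x ^ 4)) ^ r * (x ^ 5) ^ (r choose 2) + (- x) ^ Suc r * (x ^ 5) ^ (Suc r choose 2)
      = H1_term x r * qpoch x x" for r
    unfolding H1_term_def w ch power_minus[of "_ ^ _"] power_minus[of x] using qpoch_shift_ge(2)[of x 0] x
    by (simp add: algebra_simps power_add power_mult pw[of _ r] power_numeral_reduce)
  then have "(\<lambda>r. H1_term x r * qpoch x x) sums jtheta (- (x ^ 4)) (x ^ 5)"
    using jtheta_sums[of "- (x ^ 4)" "x ^ 5"] x x5 unfolding div by simp
  then have "(\<lambda>r. H1_term x r * qpoch x x / qpoch x x) sums (jtheta (- (x ^ 4)) (x ^ 5) / qpoch x x)"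
    by (rule sums_divide)
  then have "H1 x = jtheta (- (x ^ 4)) (x ^ 5) / qpoch x x"
    unfolding H1_def using qpoch_shift_ge(2)[of x 0] x by (simp add: sums_iff)
  then show "K 1 = jtheta (- (x ^ 4)) (x ^ 5) / qpoch x x"
    unfolding K_def using H1_eq[OF x] by (simp add: mult_ac)
qed

end

lemma rogers_ramanujan_rr_tail:
  assumes "0 < q" "q < 1"
  defines "L \<equiv> rogers_series.K q 0 / rogers_series.K q 1"
  shows "rogers_ramanujan q = q powr (1/5) / L" "1 \<le> L" "\<bar>rr_tail q 1 n - L\<bar> \<le> q ^ n"
proof -
  interpret rogers_series q using assms by unfold_locales
  have lim: "rr_tail q 1 \<longlonglongrightarrow> L" unfolding L_def by (rule rr_tail_LIMSEQ)
  show L1: "1 \<le> L"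
    by (rule LIMSEQ_le_const[OF lim]) (use rr_tail_ge_1[OF assms(1)] in blast)
  have "rr_convergent q \<longlonglongrightarrow> q powr (1/5) / L"
    unfolding rr_convergent_def using L1 by (intro tendsto_intros lim) auto
  then show "rogers_ramanujan q = q powr (1/5) / L"
    by (rule LIMSEQ_unique[OF rr_convergent_LIMSEQ[OF assms(1,2)]])
  show "\<bar>rr_tail q 1 n - L\<bar> \<le> q ^ n" unfolding L_def by (rule rr_tail_error)
qed

lemma rogers_ramanujan_theta:
  assumes "0 < x" "x < 1"
  shows "rogers_ramanujan x = x powr (1/5) * jtheta (- (x ^ 4)) (x ^ 5) / jtheta (- (x ^ 3)) (x ^ 5)"
proof -
  interpret rogers_series x using assms by unfold_locales
  have nz: "qpoch x x \<noteq> 0" using qpoch_shift_ge(2)[of x 0] assms by simp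
  show ?thesis unfolding rogers_ramanujan_rr_tail(1)[OF assms] K_theta using nz by simp
qed

section \<open>Functions of level ten\<close>

locale level_ten =
  fixes x :: real
  assumes x: "0 < x" "x < 1"
begin

declare One_nat_def [simp del]

definition c :: "nat \<Rightarrow> real" where "c n = qpoch (x ^ n) (x ^ 10)"
definition f :: "nat \<Rightarrow> real" where "f d = qpoch (x ^ d) (x ^ d)"
text \<open>The pairing of \<open>n\<close> with \<open>10 - n\<close> is that of the triple product
  in base \<open>x ^ 10\<close>. It turns every \<open>f d\<close> with \<open>d\<close> dividing 10
  into a monomial, so identities reduce to comparing exponents.\<close>

definition J :: "nat \<Rightarrow> real" where "J n = c n * c (10 - n)"

lemma pow_less_1: "0 < n \<Longrightarrow> x ^ n < 1"
  using x by (simp add: power_less_one_iff)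

lemma c_bounds: "0 < n \<Longrightarrow> 0 < c n" "0 < n \<Longrightarrow> c n \<le> 1 - x ^ n"
  unfolding c_def using x pow_less_1 by (auto intro!: qpoch_real_bounds)

lemma J_pos: "0 < n \<Longrightarrow> n < 10 \<Longrightarrow> 0 < J n"
  unfolding J_def using c_bounds(1) by simp

lemma f_group:
  assumes "0 < d" "0 < k" "d * k = 10"
  shows "f d = (\<Prod>i<k. c (d * Suc i))"
proof -
  have "norm (x ^ d) < 1" using pow_less_1[OF assms(1)] x by simp
  then have "f d = (\<Prod>i<k. qpoch (x ^ d * (x ^ d) ^ i) ((x ^ d) ^ k))"
    unfolding f_def using assms(2) by (rule qpoch_group)
  also have "\<dots> = (\<Prod>i<k. c (d * Suc i))"
    unfolding c_def assms(3)[symmetric] power_mult by simp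
  finally show ?thesis .
qed

lemma J5: "J 5 = c 5 ^ 2" by (simp add: J_def power2_eq_square)

lemma f_J:
  "f 1 = J 1 * J 2 * J 3 * J 4 * c 5 * c 10" "f 2 = J 2 * J 4 * c 10" "f 5 = c 5 * c 10" "f 10 = c 10"
  using f_group[of 1 10] f_group[of 2 5] f_group[of 5 2] f_group[of 10 1]
  by (simp_all add: J_def numeral_eq_Suc One_nat_def lessThan_Suc mult_ac)

lemma theta_J:
  assumes "0 < n" "n < 10"
  shows "jtheta (- (x ^ n)) (x ^ 10) = J n * c 10"
proof -
  have "x ^ 10 / x ^ n = x ^ (10 - n)" using assms x power_diff[of x n 10] by simp
  moreover have "norm (x ^ 10) < 1" using pow_less_1[of 10] x by simp
  ultimately show ?thesis
    using jacobi_triple_product[of "- (x ^ n)" "x ^ 10"] x by (simp add: J_def c_def)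
qed

lemma J_sym: "J 6 = J 4" "J 7 = J 3" "J 8 = J 2"
  by (simp_all add: J_def mult.commute)

text \<open>The three-term relation at the parameters \<open>x\<^sup>m\<^sup>/\<^sup>2\<close> with \<open>m\<close> running through
  \<open>7, 3, 5, 1\<close> and \<open>11, 3, 5, 1\<close> and \<open>8, 4, 6, 2\<close>.\<close>

lemma J_relations:
  "J 5 * J 2 ^ 2 * J 3 - J 1 * J 3 * J 4 ^ 2 = x * J 1 ^ 2 * J 2 * J 4"
  "J 2 * J 3 ^ 2 * J 4 - J 1 * J 4 ^ 2 * J 5 = x * J 1 * J 2 ^ 2 * J 3"
  "J 2 ^ 2 * J 4 ^ 2 - J 1 * J 3 * J 5 ^ 2 = x * J 1 ^ 2 * J 3 ^ 2"
proof -
  \<comment> \<open>The parameters are half-integral powers of \<open>x\<close>. The conditions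
    \<open>d \<le> b \<le> c \<le> a\<close> in \<open>rel\<close> below keep the subtractions of
    natural numbers exact.\<close>
  define s where "s = sqrt x"
  have s: "s \<noteq> 0" "s ^ 2 = x" using x by (simp_all add: s_def)
  have c10: "c 10 \<noteq> 0" using c_bounds(1)[of 10] by simp
  have x10: "x ^ 10 \<noteq> 0" "norm (x ^ 10) < 1" using pow_less_1[of 10] x by simp_all
  define \<theta> where "\<theta> n = jtheta (- (s ^ n)) (x ^ 10)" for n
  have \<theta>: "\<theta> (2 * n) = J n * c 10" if "0 < n" "n < 10" for n
    unfolding \<theta>_def power_mult s by (rule theta_J[OF that])
  have div: "s ^ m / s ^ n = s ^ (m - n)" if "n \<le> m" for m n
    using s power_diff[of s n m] that by simp
  have rel: "\<theta> (a + b) * \<theta> (a - b) * (\<theta> (c + d) * \<theta> (c - d)) - \<theta> (a + d) * \<theta> (a - d) * (\<theta> (c + b) * \<theta> (c - b))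
     = s ^ (c - b) * (\<theta> (b + d) * \<theta> (b - d) * (\<theta> (a + c) * \<theta> (a - c)))"
    if "d \<le> b" "b \<le> c" "c \<le> a" for a b c d
    using jtheta_three_term[of "s ^ a" "s ^ b" "s ^ c" "s ^ d" "x ^ 10"] s x10 that
    by (simp add: \<theta>_def div power_add)
  have th: "\<theta> 2 = J 1 * c 10" "\<theta> 4 = J 2 * c 10" "\<theta> 6 = J 3 * c 10" "\<theta> 8 = J 4 * c 10"
    "\<theta> 10 = J 5 * c 10" "\<theta> 12 = J 6 * c 10" "\<theta> 14 = J 7 * c 10" "\<theta> 16 = J 8 * c 10"
    using \<theta>[of 1] \<theta>[of 2] \<theta>[of 3] \<theta>[of 4] \<theta>[of 5] \<theta>[of 6] \<theta>[of 7] \<theta>[of 8] by simp_all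
  have "\<theta> 10 * \<theta> 4 * (\<theta> 6 * \<theta> 4) - \<theta> 8 * \<theta> 6 * (\<theta> 8 * \<theta> 2) = x * (\<theta> 4 * \<theta> 2 * (\<theta> 12 * \<theta> 2))" using rel[of 1 3 5 7] s by simp
  then have "c 10 ^ 4 * (J 5 * J 2 ^ 2 * J 3 - J 1 * J 3 * J 4 ^ 2) = c 10 ^ 4 * (x * J 1 ^ 2 * J 2 * J 4)"
    by (simp add: th J_sym algebra_simps power2_eq_square power4_eq_xxxx)
  then show "J 5 * J 2 ^ 2 * J 3 - J 1 * J 3 * J 4 ^ 2 = x * J 1 ^ 2 * J 2 * J 4" using c10 by simp
  have "\<theta> 14 * \<theta> 8 * (\<theta> 6 * \<theta> 4) - \<theta> 12 * \<theta> 10 * (\<theta> 8 * \<theta> 2) = x * (\<theta> 4 * \<theta> 2 * (\<theta> 16 * \<theta> 6))" using rel[of 1 3 5 11] s by simp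
  then have "c 10 ^ 4 * (J 2 * J 3 ^ 2 * J 4 - J 1 * J 4 ^ 2 * J 5) = c 10 ^ 4 * (x * J 1 * J 2 ^ 2 * J 3)"
    by (simp add: th J_sym algebra_simps power2_eq_square power4_eq_xxxx)
  then show "J 2 * J 3 ^ 2 * J 4 - J 1 * J 4 ^ 2 * J 5 = x * J 1 * J 2 ^ 2 * J 3" using c10 by simp
  have "\<theta> 12 * \<theta> 4 * (\<theta> 8 * \<theta> 4) - \<theta> 10 * \<theta> 6 * (\<theta> 10 * \<theta> 2) = x * (\<theta> 6 * \<theta> 2 * (\<theta> 14 * \<theta> 2))" using rel[of 2 4 6 8] s by simp
  then have "c 10 ^ 4 * (J 2 ^ 2 * J 4 ^ 2 - J 1 * J 3 * J 5 ^ 2) = c 10 ^ 4 * (x * J 1 ^ 2 * J 3 ^ 2)"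
    by (simp add: th J_sym algebra_simps power2_eq_square power4_eq_xxxx)
  then show "J 2 ^ 2 * J 4 ^ 2 - J 1 * J 3 * J 5 ^ 2 = x * J 1 ^ 2 * J 3 ^ 2" using c10 by simp
qed

text \<open>\<open>w\<close> and \<open>k\<close> are Hauptmoduln: \<open>w\<close> of \<open>\<Gamma>\<^sub>0(10)\<close>, and \<open>k = R(x) R(x\<^sup>2)\<^sup>2\<close> is Ramanujan's parameter.\<close>

definition k :: real where "k = x * J 1 * J 2 / (J 3 * J 4)"
definition w :: real where "w = J 5 ^ 2 / (x * J 1 * J 3)"
text \<open>For \<open>x = exp (- pi * sqrt r)\<close> and tau = i sqrt r, \<open>h\<close> is
  (eta(tau)/eta(5 tau))^6 and \<open>u\<close> is (eta(tau/2)/eta(tau))^24.\<close>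

definition h :: real where "h = f 2 ^ 6 / (x ^ 2 * f 10 ^ 6)"
definition u :: real where "u = f 1 ^ 24 / (x * f 2 ^ 24)"

lemma pos: "0 < x" "0 < J 1" "0 < J 2" "0 < J 3" "0 < J 4" "0 < J 5" "0 < c 5" "0 < c 10"
  using x J_pos c_bounds(1) by auto

lemma nz: "x \<noteq> 0" "J 1 \<noteq> 0" "J 2 \<noteq> 0" "J 3 \<noteq> 0" "J 4 \<noteq> 0" "J 5 \<noteq> 0" "c 5 \<noteq> 0" "c 10 \<noteq> 0"
  using pos by auto

lemma k_nz: "k \<noteq> 0" using nz by (simp add: k_def)

text \<open>Divided by a monomial, the second of the \<open>J_relations\<close> expresses
  \<open>1 - k\<close> as a monomial; the first does so for \<open>1 + k\<close>. Hence
  \<open>1 / k - k\<close> is a monomial as well.\<close>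

lemma one_minus_k: "1 - k = J 5 * J 1 * J 4 / (J 2 * J 3 ^ 2)"
proof -
  have "1 - k = (J 2 * J 3 ^ 2 * J 4 - x * J 1 * J 2 ^ 2 * J 3) / (J 2 * J 3 ^ 2 * J 4)"
    using nz by (simp add: k_def field_simps power2_eq_square)
  also have "J 2 * J 3 ^ 2 * J 4 - x * J 1 * J 2 ^ 2 * J 3 = J 1 * J 4 ^ 2 * J 5"
    using J_relations(2) by simp
  finally show ?thesis using nz by (simp add: field_simps power2_eq_square)
qed

lemma one_plus_k: "1 + k = J 5 * J 2 ^ 2 / (J 1 * J 4 ^ 2)"
proof -
  have "1 + k = (J 1 * J 3 * J 4 ^ 2 + x * J 1 ^ 2 * J 2 * J 4) / (J 1 * J 3 * J 4 ^ 2)"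
    using nz by (simp add: k_def field_simps power2_eq_square)
  also have "J 1 * J 3 * J 4 ^ 2 + x * J 1 ^ 2 * J 2 * J 4 = J 5 * J 2 ^ 2 * J 3"
    using J_relations(1) by simp
  finally show ?thesis using nz by (simp add: field_simps power2_eq_square)
qed

lemma w_k: "w = 1 / k - k"
proof -
  have "1 / k - k = (1 - k) * (1 + k) / k" using k_nz by (simp add: field_simps)
  also have "\<dots> = w" unfolding one_minus_k one_plus_k unfolding w_def k_def using nz
    by (simp add: field_simps power2_eq_square)
  finally show ?thesis ..
qed

lemma w_plus_1: "w + 1 = J 2 ^ 2 * J 4 ^ 2 / (x * J 1 ^ 2 * J 3 ^ 2)"
proof -
  have "w + 1 = (J 1 * J 3 * J 5 ^ 2 + x * J 1 ^ 2 * J 3 ^ 2) / (x * J 1 ^ 2 * J 3 ^ 2)"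
    using nz by (simp add: w_def field_simps power2_eq_square)
  also have "J 1 * J 3 * J 5 ^ 2 + x * J 1 ^ 2 * J 3 ^ 2 = J 2 ^ 2 * J 4 ^ 2"
    using J_relations(3) by simp
  finally show ?thesis .
qed

text \<open>The quintic identity is divided by x psi(x^5)^2, which is
  \<open>x * (c 10 / c 5) ^ 2\<close>. The quotient of the psi squares is \<open>w + 1\<close>, so
  the 5 of the identity becomes the shift by 4.\<close>

lemma w_minus_4: "w - 4 = J 1 ^ 3 * J 2 ^ 2 * J 3 ^ 3 * J 4 ^ 2 * J 5 ^ 2 / x"
proof -
  have "f 1 ^ 3 * f 10 / (f 2 * f 5) = (f 2 ^ 2 / f 1) ^ 2 - 5 * x * (f 10 ^ 2 / f 5) ^ 2"
    unfolding f_def by (rule psi_quintic_identity[OF x])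
  moreover have "f 1 ^ 3 * f 10 / (f 2 * f 5) = (J 1 ^ 3 * J 2 ^ 2 * J 3 ^ 3 * J 4 ^ 2 * J 5 ^ 2 / x) * (x * (c 10 / c 5) ^ 2)"
    unfolding f_J J5 using nz by (simp add: field_simps power_numeral_reduce)
  moreover have "(f 2 ^ 2 / f 1) ^ 2 = J 2 ^ 2 * J 4 ^ 2 / (x * J 1 ^ 2 * J 3 ^ 2) * (x * (c 10 / c 5) ^ 2)"
    unfolding f_J using nz by (simp add: field_simps power_numeral_reduce)
  moreover have "5 * x * (f 10 ^ 2 / f 5) ^ 2 = 5 * (x * (c 10 / c 5) ^ 2)"
    unfolding f_J using nz by (simp add: field_simps power_numeral_reduce)
  ultimately have "(J 1 ^ 3 * J 2 ^ 2 * J 3 ^ 3 * J 4 ^ 2 * J 5 ^ 2 / x) * (x * (c 10 / c 5) ^ 2)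
     = (w + 1 - 5) * (x * (c 10 / c 5) ^ 2)"
    unfolding w_plus_1 by (simp only: left_diff_distrib)
  moreover have "x * (c 10 / c 5) ^ 2 \<noteq> 0" using nz by simp
  ultimately have "J 1 ^ 3 * J 2 ^ 2 * J 3 ^ 3 * J 4 ^ 2 * J 5 ^ 2 / x = w + 1 - 5"
    by (metis mult_right_cancel)
  then show ?thesis by simp
qed

lemma w_nz: "w \<noteq> 0" "w + 1 \<noteq> 0" "w - 4 \<noteq> 0"
  unfolding w_plus_1 w_minus_4 unfolding w_def using nz by simp_all

text \<open>The exponents 2, 1, -1 are those for which \<open>E\<close> and \<open>J 5\<close>
  cancel.\<close>

lemma h_w: "h = (w + 1) ^ 2 * (w - 4) / w"
proof -
  define D where "D = J 2 * J 4"
  define E where "E = J 1 * J 3"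
  have 1: "w = J 5 ^ 2 / (x * E)" "w + 1 = D ^ 2 / (x * E ^ 2)" "w - 4 = E ^ 3 * D ^ 2 * J 5 ^ 2 / x"
    unfolding w_plus_1 w_minus_4 unfolding w_def D_def E_def by (simp_all add: power_mult_distrib mult_ac)
  have 2: "h = D ^ 6 / x ^ 2" unfolding h_def f_J D_def using nz by (simp add: power_mult_distrib)
  have "D \<noteq> 0" "E \<noteq> 0" unfolding D_def E_def using nz by simp_all
  then show ?thesis unfolding 1(2,3) 2 unfolding 1(1) using nz
    by (simp add: divide_simps power_numeral_reduce)
qed

lemma u_w: "u = w * (w - 4) ^ 5 / (w + 1) ^ 5"
proof -
  define E where "E = J 1 * J 3"
  have E: "E \<noteq> 0" unfolding E_def using nz by simp
  have 1: "(w - 4) / (w + 1) = E ^ 5 * J 5 ^ 2"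
    unfolding w_plus_1 w_minus_4 E_def using nz by (simp add: field_simps power_numeral_reduce)
  have 2: "w = J 5 ^ 2 / (x * E)" by (simp add: w_def E_def mult_ac)
  have f1: "f 1 = E * c 5 * f 2" by (simp add: f_J E_def mult_ac)
  have f2: "f 2 \<noteq> 0" using nz by (simp add: f_J)
  have "u = (E * c 5) ^ 24 / x"
    unfolding u_def f1 power_mult_distrib[of _ "f 2"] using f2 by simp
  also have "\<dots> = E ^ 24 * J 5 ^ 12 / x"
    by (simp add: J5 power_mult_distrib flip: power_mult)
  also have "\<dots> = J 5 ^ 2 / (x * E) * (E ^ 5 * J 5 ^ 2) ^ 5"
    using E by (simp add: power_mult_distrib power_numeral_reduce flip: power_mult)
  also have "\<dots> = w * ((w - 4) / (w + 1)) ^ 5" unfolding 1 unfolding 2 ..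
  finally show ?thesis by (simp add: power_divide)
qed

lemma j_h: "(u + 16) ^ 3 / u = (h^2 + 250 * h + 3125) ^ 3 / h ^ 5"
proof -
  define N where "N = w * (w - 4) ^ 5 + 16 * (w + 1) ^ 5"
  have 1: "u + 16 = N / (w + 1) ^ 5"
    unfolding u_w N_def using w_nz by (simp add: field_simps)
  \<comment> \<open>This identity between polynomials of degree 6 is the whole reason why the
    formulas for j at levels 2 and 5 agree.\<close>
  have "N = (w + 1) ^ 4 * (w - 4) ^ 2 + 250 * w * (w + 1) ^ 2 * (w - 4) + 3125 * w ^ 2"
    unfolding N_def by (simp add: algebra_simps power_numeral_reduce)
  moreover have "((w + 1) ^ 2 * (w - 4)) ^ 2 = (w + 1) ^ 4 * (w - 4) ^ 2"
    by (simp add: power_mult_distrib flip: power_mult)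
  ultimately have "N = ((w + 1) ^ 2 * (w - 4)) ^ 2 + 250 * w * ((w + 1) ^ 2 * (w - 4)) + 3125 * w ^ 2"
    by (simp only: mult.assoc)
  then have 2: "h^2 + 250 * h + 3125 = N / w ^ 2"
    unfolding h_w using w_nz(1) by (simp add: power_divide add_divide_distrib power2_eq_square mult_ac)
  have 3: "w ^ 6 * h ^ 5 = w * (w + 1) ^ 10 * (w - 4) ^ 5"
  proof -
    have "h * w = (w + 1) ^ 2 * (w - 4)" unfolding h_w using w_nz(1) by simp
    moreover have "w ^ 6 * h ^ 5 = w * (h * w) ^ 5"
      by (simp add: power_mult_distrib power_numeral_reduce)
    ultimately show ?thesis by (simp add: power_mult_distrib mult_ac flip: power_mult)
  qed
  have 4: "(w + 1) ^ 15 * u = w * (w + 1) ^ 10 * (w - 4) ^ 5"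
  proof -
    have "(w + 1) ^ 5 * u = w * (w - 4) ^ 5" unfolding u_w using w_nz(2) by simp
    then have "(w + 1) ^ 10 * ((w + 1) ^ 5 * u) = (w + 1) ^ 10 * (w * (w - 4) ^ 5)" by simp
    then show ?thesis by (simp add: mult_ac flip: power_add)
  qed
  have "(u + 16) ^ 3 / u = N ^ 3 / ((w + 1) ^ 15 * u)"
    unfolding 1 by (simp add: power_divide flip: power_mult)
  also have "\<dots> = N ^ 3 / (w ^ 6 * h ^ 5)" unfolding 4 3 ..
  also have "\<dots> = (h^2 + 250 * h + 3125) ^ 3 / h ^ 5"
    unfolding 2 by (simp add: power_divide flip: power_mult)
  finally show ?thesis .
qed

text \<open>The argument is \<open>x ^ 2\<close> because \<open>x\<close> is the square root of the
  nome of the theorem. The theta quotient has base \<open>x ^ 10\<close> and reduces to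
  \<open>J 2 / J 4\<close>; its fifth power is a monomial in \<open>k\<close>, \<open>1 + k\<close>
  and \<open>1 - k\<close>.\<close>

lemma R_pow_5: "rogers_ramanujan (x ^ 2) ^ 5 = k ^ 2 * (1 + k) / (1 - k)"
proof -
  have "rogers_ramanujan (x ^ 2) = (x ^ 2) powr (1/5) * (J 2 * c 10) / (J 4 * c 10)"
    using rogers_ramanujan_theta[of "x ^ 2"] x pow_less_1[of 2] theta_J[of 8] theta_J[of 6]
    by (simp add: J_sym flip: power_mult)
  then have "rogers_ramanujan (x ^ 2) = (x ^ 2) powr (1/5) * (J 2 / J 4)" using nz by simp
  moreover have "((x ^ 2) powr (1/5)) ^ 5 = x ^ 2"
    using x by (simp add: powr_power)
  ultimately have "rogers_ramanujan (x ^ 2) ^ 5 = x ^ 2 * (J 2 / J 4) ^ 5"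
    by (simp only: power_mult_distrib)
  also have "\<dots> = k ^ 2 * (1 + k) / (1 - k)"
    unfolding one_plus_k one_minus_k unfolding k_def using nz by (simp add: field_simps power_numeral_reduce)
  finally show ?thesis .
qed

lemma R_h: "rogers_ramanujan (x ^ 2) powi (-5) - 11 - rogers_ramanujan (x ^ 2) ^ 5 = h"
proof -
  have k: "k \<noteq> 0" "1 - k \<noteq> 0" "1 + k \<noteq> 0"
    unfolding one_plus_k one_minus_k using nz by (simp_all add: k_def)
  have w1: "1 / k - k \<noteq> 0" using w_nz(1) unfolding w_k .
  have "rogers_ramanujan (x ^ 2) powi (-5) = inverse (rogers_ramanujan (x ^ 2) ^ 5)"
    by (simp add: power_int_minus)
  then have "rogers_ramanujan (x ^ 2) powi (-5) - 11 - rogers_ramanujan (x ^ 2) ^ 5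
     = (1 - k) / (k ^ 2 * (1 + k)) - 11 - k ^ 2 * (1 + k) / (1 - k)"
    by (simp add: R_pow_5)
  also have "\<dots> = ((1 - k) ^ 2 - 11 * (k ^ 2 * (1 + k) * (1 - k)) - (k ^ 2 * (1 + k)) ^ 2) / (k ^ 2 * (1 + k) * (1 - k))"
    using k by (simp add: divide_simps power2_eq_square) (simp add: algebra_simps)
  \<comment> \<open>The constant 11 is what makes this numerator factor; divided by
    \<open>k\<close>, the two factors are \<open>w + 1\<close> and \<open>w - 4\<close>.\<close>
  also have "(1 - k) ^ 2 - 11 * (k ^ 2 * (1 + k) * (1 - k)) - (k ^ 2 * (1 + k)) ^ 2
     = (1 - k ^ 2 + k) ^ 2 * (1 - k ^ 2 - 4 * k)"
    by (simp add: algebra_simps power_numeral_reduce)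
  also have "\<dots> / (k ^ 2 * (1 + k) * (1 - k)) = ((1 - k ^ 2 + k) / k) ^ 2 * ((1 - k ^ 2 - 4 * k) / k) / (((1 + k) * (1 - k)) / k)"
    using k by (simp add: power_divide power2_eq_square)
  also have "\<dots> = (w + 1) ^ 2 * (w - 4) / w"
  proof -
    have "(1 - k ^ 2 + k) / k = w + 1" "(1 - k ^ 2 - 4 * k) / k = w - 4" "(1 + k) * (1 - k) / k = w"
      unfolding w_k using k(1) by (simp_all add: field_simps power2_eq_square)
    then show ?thesis by simp
  qed
  finally show ?thesis unfolding h_w .
qed

text \<open>The product form shows that \<open>A_r\<close> is positive and becomes small as the nome
  tends to 1, the end of the range that the continued fraction does not control directly.\<close>

lemma h_bounds: "0 < h" "h \<le> (1 - x ^ 2) / x ^ 2"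
proof -
  have h: "h = (J 2 * J 4) ^ 6 / x ^ 2" unfolding h_def f_J using nz by (simp add: power_mult_distrib)
  have J24: "0 < J 2 * J 4" using pos by simp
  have c1: "0 < c n \<and> c n \<le> 1" if "0 < n" for n
    using c_bounds[OF that] zero_less_power[OF x(1), of n] by linarith
  have "J 2 * J 4 = c 2 * (c 8 * (c 4 * c 6))" by (simp add: J_def mult_ac)
  also have "\<dots> \<le> c 2 * 1"
    using c1[of 2] c1[of 4] c1[of 6] c1[of 8] by (intro mult_left_mono mult_le_one) (auto intro: less_imp_le)
  also have "\<dots> \<le> 1 - x ^ 2" using c_bounds(2)[of 2] by simp
  finally have le: "J 2 * J 4 \<le> 1 - x ^ 2" .
  then have "J 2 * J 4 \<le> 1" using x by (smt (verit) zero_le_power)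
  then have "(J 2 * J 4) ^ 6 \<le> (J 2 * J 4) ^ 1" using J24 by (intro power_decreasing) auto
  then show "h \<le> (1 - x ^ 2) / x ^ 2" unfolding h using le x by (intro divide_right_mono) auto
  show "0 < h" unfolding h by (intro divide_pos_pos zero_less_power J24 x(1))
qed

end

section \<open>Continuity of R and the range of A\<close>

lemma continuous_on_rr_tail:
  assumes "A \<subseteq> {0<..}"
  shows "continuous_on A (\<lambda>q. rr_tail q k n)"
proof (induction n arbitrary: k)
  case (Suc n)
  have "rr_tail q (Suc k) n \<noteq> 0" if "q \<in> A" for q
    using rr_tail_ge_1[of q "Suc k" n] assms that by force
  then show ?case by (auto intro!: continuous_intros Suc)
qed simp

text \<open>On \<open>{a..b}\<close> the error \<open>q ^ n\<close> is at most \<open>b ^ n\<close>,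
  so the finite fractions converge uniformly and their continuity passes to the limit.\<close>

lemma continuous_on_rogers_ramanujan:
  assumes "0 < a" "b < 1"
  shows "continuous_on {a..b} rogers_ramanujan"
proof -
  define L where "L q = rogers_series.K q 0 / rogers_series.K q 1" for q
  have L: "rogers_ramanujan q = q powr (1/5) / L q" "1 \<le> L q" "\<bar>rr_tail q 1 n - L q\<bar> \<le> q ^ n"
    if "q \<in> {a..b}" for q n
    using rogers_ramanujan_rr_tail[of q] that assms unfolding L_def by auto
  have unif: "uniform_limit {a..b} (\<lambda>n q. rr_tail q 1 n) L sequentially"
  proof (rule uniform_limitI)
    fix e :: real assume "e > 0"
    show "\<forall>\<^sub>F n in sequentially. \<forall>q\<in>{a..b}. dist (rr_tail q 1 n) (L q) < e"
    proof (cases "a \<le> b")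
      case True
      then have "(\<lambda>n. b ^ n) \<longlonglongrightarrow> 0" using assms by (intro LIMSEQ_realpow_zero) auto
      then have "\<forall>\<^sub>F n in sequentially. b ^ n < e" using \<open>e > 0\<close> by (rule order_tendstoD)
      then show ?thesis
      proof eventually_elim
        case (elim n)
        show ?case
        proof
          fix q assume q: "q \<in> {a..b}"
          then have "q ^ n \<le> b ^ n" using assms by (intro power_mono) auto
          then show "dist (rr_tail q 1 n) (L q) < e" using L(3)[OF q, of n] elim by (simp add: dist_real_def)
        qed
      qed
    qed simp
  qed
  have "\<forall>\<^sub>F n in sequentially. continuous_on {a..b} (\<lambda>q. rr_tail q 1 n)"
    using assms by (intro always_eventually allI continuous_on_rr_tail) auto
  then have "continuous_on {a..b} L"
    by (rule uniform_limit_theorem[OF _ unif]) simp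
  then have "continuous_on {a..b} (\<lambda>q. q powr (1/5) / L q)"
    using L(2) assms by (intro continuous_intros) force+
  then show ?thesis by (rule continuous_on_cong[THEN iffD1, rotated 2]) (simp_all add: L(1))
qed

definition A_fun :: "real \<Rightarrow> real" where
  "A_fun q = rogers_ramanujan q powi (-5) - 11 - rogers_ramanujan q ^ 5"

lemma A_fun_surj:
  assumes "0 < y"
  obtains q where "0 < q" "q < 1" "A_fun q = y"
proof -
  \<comment> \<open>At \<open>b\<close> the bound \<open>(1 - b) / b\<close> for
    \<open>A_fun b\<close> is exactly \<open>y\<close>. At \<open>a\<close> the inequality R^5 \<le>
    \<open>a\<close> gives R^(-5) \<ge> \<open>y + 12\<close>, and subtracting 11 and R^5 \<le> 1
    still leaves at least \<open>y\<close>.\<close>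
  define a where "a = 1 / (y + 12)"
  define b where "b = 1 / (1 + y)"
  have ab: "0 < a" "a < 1" "a \<le> b" "0 < b" "b < 1" using assms by (auto simp: a_def b_def field_simps)
  have pos: "0 < rogers_ramanujan q" if "0 < q" "q < 1" for q
  proof -
    define L where "L = rogers_series.K q 0 / rogers_series.K q 1"
    have "rogers_ramanujan q = q powr (1/5) / L" "1 \<le> L"
      using rogers_ramanujan_rr_tail[OF that] unfolding L_def by auto
    then show ?thesis using that by simp
  qed
  have "rogers_ramanujan q \<noteq> 0" if "q \<in> {a..b}" for q
    using pos[of q] that ab by auto
  then have "continuous_on {a..b} A_fun"
    unfolding A_fun_def using ab
    by (intro continuous_intros continuous_on_rogers_ramanujan) auto
  moreover have "A_fun b \<le> y"
  proof -
    interpret level_ten "sqrt b" using ab by unfold_locales auto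
    have "A_fun b = h" using R_h ab by (simp add: A_fun_def)
    also have "\<dots> \<le> (1 - b) / b" using h_bounds(2) ab by simp
    also have "\<dots> = y" using assms by (simp add: b_def field_simps)
    finally show ?thesis .
  qed
  moreover have "y \<le> A_fun a"
  proof -
    define L where "L = rogers_series.K a 0 / rogers_series.K a 1"
    have L: "rogers_ramanujan a = a powr (1/5) / L" "1 \<le> L"
      using rogers_ramanujan_rr_tail[of a] ab unfolding L_def by auto
    have R5: "rogers_ramanujan a ^ 5 = a / L ^ 5"
      unfolding L(1) using ab by (simp add: power_divide powr_power)
    have le: "rogers_ramanujan a ^ 5 \<le> a"
      unfolding R5 using L(2) ab by (simp add: divide_le_eq mult_le_cancel_left1)
    have gt: "0 < rogers_ramanujan a ^ 5" unfolding R5 using L(2) ab by simp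
    have "1 / a \<le> 1 / rogers_ramanujan a ^ 5"
      using le gt ab by (intro divide_left_mono mult_pos_pos) auto
    moreover have "rogers_ramanujan a ^ 5 \<le> 1" using le ab by linarith
    moreover have "1 / a = y + 12" by (simp add: a_def)
    ultimately show ?thesis by (simp add: A_fun_def power_int_minus divide_inverse)
  qed
  ultimately obtain q where "a \<le> q" "q \<le> b" "A_fun q = y"
    using IVT2'[of A_fun b y a] ab by blast
  then show thesis using that[of q] ab by auto
qed

section \<open>Eta on the imaginary axis and the parametrisation of the curve\<close>

lemma dedekind_eta_imaginary:
  assumes "0 < s"
  defines "q \<equiv> exp (- 2 * pi * s)"
  shows "dedekind_eta (\<i> * of_real s) = of_real (exp (- pi * s / 12) * qpoch q q)"
proof -
  have q: "0 < q" "q < 1" using assms by (auto simp: q_def)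
  have "exp (2 * of_real pi * \<i> * of_nat (Suc n) * (\<i> * of_real s)) = of_real q * (of_real q ^ n :: complex)" for n
  proof -
    have "2 * of_real pi * \<i> * of_nat (Suc n) * (\<i> * of_real s) = of_nat (Suc n) * complex_of_real (- 2 * pi * s)"
      by (simp add: complex_eq_iff)
    then show ?thesis
      unfolding q_def by (simp only: exp_of_nat_mult exp_of_real power_Suc)
  qed
  then have "(\<Prod>n. 1 - exp (2 * of_real pi * \<i> * of_nat (Suc n) * (\<i> * of_real s))) = qpoch (of_real q) (of_real q :: complex)"
    unfolding qpoch_def by simp
  also have "\<dots> = of_real (qpoch q q)" using q by (intro qpoch_of_real) auto
  finally have prod: "(\<Prod>n. 1 - exp (2 * of_real pi * \<i> * of_nat (Suc n) * (\<i> * of_real s))) = complex_of_real (qpoch q q)" .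
  have "of_real pi * \<i> * (\<i> * of_real s) / 12 = complex_of_real (- pi * s / 12)"
    by (simp add: complex_eq_iff)
  then have "exp (of_real pi * \<i> * (\<i> * of_real s) / 12) = complex_of_real (exp (- pi * s / 12))"
    by (simp only: exp_of_real)
  then show ?thesis unfolding dedekind_eta_def prod by simp
qed

lemma j_val_eq:
  assumes "0 < r" and A: "0 < A_val r"
  shows "j_val r = of_real ((A_val r ^ 2 + 250 * A_val r + 3125) ^ 3 / A_val r ^ 5)"
proof -
  \<comment> \<open>As a 24th root of \<open>x\<close>, \<open>e\<close> makes the exponential
    prefactors of both eta values the integral powers \<open>e\<close> and
    \<open>e ^ 2\<close>.\<close>
  define e where "e = exp (- pi * sqrt r / 24)"
  have sr: "0 < sqrt r" using assms by simp
  define x where "x = e ^ 24"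
  have x_exp: "x = exp (- pi * sqrt r)" unfolding x_def e_def by (simp flip: exp_of_nat_mult)
  have x2_exp: "x ^ 2 = exp (- 2 * pi * sqrt r)" unfolding x_exp by (simp flip: exp_of_nat_mult)
  have e2: "e ^ 2 = exp (- pi * sqrt r / 12)" unfolding e_def by (simp flip: exp_of_nat_mult)
  have x: "0 < x" "x < 1" unfolding x_exp using sr by auto
  interpret level_ten x using x by unfold_locales
  have e: "e \<noteq> 0" by (simp add: e_def)
  have "f 1 \<noteq> 0" "f 2 \<noteq> 0" using nz by (simp_all add: f_J)
  have eta: "dedekind_eta (\<i> * of_real (sqrt r)) = of_real (e ^ 2 * f 2)"
    using dedekind_eta_imaginary[OF sr] unfolding e2 f_def x2_exp .
  have eta': "dedekind_eta (\<i> * of_real (sqrt r) / 2) = of_real (e * f 1)"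
  proof -
    have "exp (- 2 * pi * (sqrt r / 2)) = x" "exp (- pi * (sqrt r / 2) / 12) = e"
      by (simp_all add: x_exp e_def)
    then have "dedekind_eta (\<i> * of_real (sqrt r / 2)) = of_real (e * qpoch x x)"
      using dedekind_eta_imaginary[of "sqrt r / 2"] sr by simp
    then show ?thesis by (simp add: f_def)
  qed
  have h: "A_val r = h" using R_h unfolding A_val_def x2_exp .
  define g where "g = f 1 / (e * f 2)"
  have g: "g \<noteq> 0" using e \<open>f 1 \<noteq> 0\<close> \<open>f 2 \<noteq> 0\<close> by (simp add: g_def)
  have g24: "g ^ 24 = u" 
    unfolding g_def u_def by (simp add: power_divide power_mult_distrib flip: x_def)
  have "e * f 1 / (e ^ 2 * f 2) = g" "e ^ 2 * f 2 / (e * f 1) = 1 / g"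
    using e by (simp_all add: g_def power2_eq_square)
  then have "dedekind_eta (\<i> * of_real (sqrt r) / 2) / dedekind_eta (\<i> * of_real (sqrt r)) = of_real g"
    "dedekind_eta (\<i> * of_real (sqrt r)) / dedekind_eta (\<i> * of_real (sqrt r) / 2) = of_real (1 / g)"
    unfolding eta eta' by (simp_all only: of_real_divide[symmetric])
  then have "j_val r = of_real ((g ^ 16 + 16 * (1 / g) ^ 8) ^ 3)"
    unfolding j_val_def Let_def by simp
  also have "g ^ 16 + 16 * (1 / g) ^ 8 = (g ^ 24 + 16) / g ^ 8"
    using g by (simp add: field_simps flip: power_add)
  also have "\<dots> ^ 3 = (u + 16) ^ 3 / u"
    by (simp add: power_divide g24 flip: power_mult)
  finally show ?thesis unfolding h j_h .
qed

theorem theorem4: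
  fixes b t :: real
  assumes "b \<noteq> 0"
    and "4 * b^2 - 10 * b * t^2 + 5 * t^4 \<ge> 0"
    and "25 * (- 5 * b + 5 * t^2 + sqrt 5 * sqrt (4 * b^2 - 10 * b * t^2 + 5 * t^4)) / b > 0"
  shows "\<exists>r>0.
      A_val r = 25 * (- 5 * b + 5 * t^2 + sqrt 5 * sqrt (4 * b^2 - 10 * b * t^2 + 5 * t^4)) / b \<and>
      j_val r = complex_of_real (25000 * t^6 /
        (b * (- 5 * b + 5 * t^2 + sqrt 5 * sqrt (4 * b^2 - 10 * b * t^2 + 5 * t^4))^2))"
proof -
  define u where "u = - 5 * b + 5 * t^2 + sqrt 5 * sqrt (4 * b^2 - 10 * b * t^2 + 5 * t^4)"
  define y where "y = 25 * u / b"
  \<comment> \<open>Squaring away the root exhibits \<open>u\<close> as a solution of a quadratic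
    equation. For \<open>y = 25 * u / b\<close> that equation turns
    \<open>y^2 + 250 * y + 3125\<close> into a monomial, so the cube collapses to a multiple of
    \<open>t^6\<close>.\<close>
  have "(u + 5 * b - 5 * t^2)^2 = 5 * (4 * b^2 - 10 * b * t^2 + 5 * t^4)"
    unfolding u_def using assms(2) by (simp add: power_mult_distrib)
  then have quad: "u^2 + 10 * u * b + 5 * b^2 = 10 * u * t^2"
    by (simp add: algebra_simps power2_eq_square power4_eq_xxxx)
  have y: "0 < y" using assms(3) unfolding y_def u_def .
  then have u: "u \<noteq> 0" by (auto simp: y_def)
  obtain q where q: "0 < q" "q < 1" "A_fun q = y" using A_fun_surj[OF y] .
  \<comment> \<open>This solves \<open>exp (- 2 * pi * sqrt r) = q\<close>; as \<open>ln q\<close>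
    is negative, the square root of \<open>r\<close> is \<open>- ln q / (2 * pi)\<close>.\<close>
  define r where "r = (ln q / (2 * pi))^2"
  have lnq: "ln q < 0" using q by simp
  have "sqrt r = - ln q / (2 * pi)" using lnq by (simp add: r_def abs_if divide_neg_pos)
  then have "exp (- 2 * pi * sqrt r) = q" using q by simp
  then have A: "A_val r = y" using q(3) by (simp add: A_val_def A_fun_def)
  have r: "0 < r" using lnq by (simp add: r_def)
  have "y^2 + 250 * y + 3125 = 625 / b^2 * (u^2 + 10 * u * b + 5 * b^2)"
    using assms(1) by (simp add: y_def field_simps power2_eq_square)
  also have "\<dots> = 625 / b^2 * (10 * u * t^2)" unfolding quad ..
  finally have "(y^2 + 250 * y + 3125) ^ 3 / y ^ 5 = (625 / b^2 * (10 * u * t^2)) ^ 3 / (25 * u / b) ^ 5"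
    by (simp add: y_def)
  also have "\<dots> = 25000 * t^6 / (b * u^2)"
    using assms(1) u by (simp add: field_simps power_numeral_reduce)
  finally have "j_val r = of_real (25000 * t^6 / (b * u^2))"
    using j_val_eq[OF r] y unfolding A by simp
  then show ?thesis using A r unfolding y_def u_def by blast
qed

end
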